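(* Let $d\ge1$, let $\kappa\in\mathbb{R}^{d+1}$ with $\kappa_i>-1$ for all $i$, and let $0\le n\le N$ be integers. Then the reproducing kernel $P_n(W_\kappa;\cdot,\cdot)$ of $\mathcal{V}_n^d(W_\kappa)$ satisfies, for all $x,y\in\mathbb{R}^d$, $$P_n(W_\kappa;x,y)=\frac{(|\kappa|+d+1)_{N+n}\,N!}{(-1)^n(-N)_n}\sum_{\alpha\in\mathbb{N}_0^{d+1},\,|\alpha|=N}\frac{1}{(\kappa+\mathbf 1)_\alpha\,\alpha!}\,R_{\alpha,n}^\kappa(x)\,R_{\alpha,n}^\kappa(y).$$
   Context: Notation: $(a)_k=a(a+1)\cdots(a+k-1)$; for vectors, $|\cdot|$ is the sum of the components, $\alpha!=\prod_i\alpha_i!$, $\mathbf 1=(1,\ldots,1)$, $(\kappa+\mathbf 1)_\alpha=\prod_{i=1}^{d+1}(\kappa_i+1)_{\alpha_i}$. Jacobi inner product on the simplex $T^d=\{x\in\mathbb{R}^d: x_i\ge 0,\ |x|\le 1\}$: with $W_\kappa(x)=x_1^{\kappa_1}\cdots x_d^{\kappa_d}(1-|x|)^{\kappa_{d+1}}$, $\langle f,g\rangle_{W_\kappa}=c\int_{T^d}f(x)g(x)W_\kappa(x)\,dx$ with $c=\Gamma(|\kappa|+d+1)/\prod_{i=1}^{d+1}\Gamma(\kappa_i+1)$, so $\langle 1,1\rangle_{W_\kappa}=1$. $\mathcal{V}_n^d(W_\kappa)$ is the space of polynomials of degree at most $n$ in $d$ variables that are orthogonal to all polynomials of degree at most $n-1$.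 Its reproducing kernel $P_n(W_\kappa;x,y)$ is the unique function that belongs to $\mathcal{V}_n^d(W_\kappa)$ in each of the variables $x$ and $y$ and satisfies $\langle P_n(W_\kappa;x,\cdot),Q\rangle_{W_\kappa}=Q(x)$ for all $Q\in\mathcal{V}_n^d(W_\kappa)$. For $x\in\mathbb{R}^d$ put $X=(x_1,\ldots,x_d,1-|x|)$. For $\alpha\in\mathbb{N}_0^{d+1}$, $R_{\alpha,n}^\kappa$ denotes the orthogonal projection (with respect to $\langle\cdot,\cdot\rangle_{W_\kappa}$) of the polynomial $x\mapsto X^\alpha$ onto $\mathcal{V}_n^d(W_\kappa)$. *)

theory Defs
  imports "HOL-Analysis.Analysis"
begin

text \<open>
  Points of d-space are vectors of type \<open>real ^ 'd\<close>, with d = \<open>CARD('d)\<close>. The d + 1 positions of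
  the parameter \<open>\<kappa>\<close>, of the homogeneous coordinates X and of the multi-indices \<open>\<alpha>\<close> are
  indexed by \<open>'d option\<close>: \<open>Some i\<close> is position i, and \<open>None\<close> is position d + 1.
  Multi-indices are functions into \<open>nat\<close>.
\<close>

definition vmonom :: "real ^ 'a \<Rightarrow> ('a::finite \<Rightarrow> nat) \<Rightarrow> real" where
  "vmonom x \<alpha> = (\<Prod>i\<in>UNIV. (x $ i) ^ \<alpha> i)"

text \<open>Polynomials are identified with the functions they induce on all of \<open>real ^ 'd\<close>.\<close>

definition polys_upto :: "nat \<Rightarrow> (real ^ 'd::finite \<Rightarrow> real) set" where
  "polys_upto n =
     {p. \<exists>c. \<forall>x. p x = (\<Sum>\<beta> | sum \<beta> UNIV \<le> n. c \<beta> * vmonom x \<beta>)}"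

definition simplex_T :: "(real ^ 'd::finite) set" where
  "simplex_T = {x. (\<forall>i. 0 \<le> x $ i) \<and> (\<Sum>i\<in>UNIV. x $ i) \<le> 1}"

text \<open>
  Since \<open>0 powr a = 0\<close> for every \<open>a\<close>, the weight vanishes on the boundary of the simplex;
  this set has Lebesgue measure zero, so the integrals below are not affected.
\<close>

definition jacobi_weight :: "real ^ ('d option) \<Rightarrow> real ^ 'd::finite \<Rightarrow> real" where
  "jacobi_weight \<kappa> x =
     (\<Prod>i\<in>UNIV. (x $ i) powr (\<kappa> $ Some i)) * (1 - (\<Sum>i\<in>UNIV. x $ i)) powr (\<kappa> $ None)"

definition jacobi_inner ::
  "real ^ ('d option) \<Rightarrow> (real ^ 'd::finite \<Rightarrow> real) \<Rightarrow> (real ^ 'd \<Rightarrow> real) \<Rightarrow> real" where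
  "jacobi_inner \<kappa> f g =
     Gamma ((\<Sum>i\<in>UNIV. \<kappa> $ i) + real CARD('d) + 1) / (\<Prod>i\<in>UNIV. Gamma (\<kappa> $ i + 1))
       * (LINT x:simplex_T|lborel. f x * g x * jacobi_weight \<kappa> x)"

text \<open>
  Quantifying over degree bounds \<open>m < n\<close> instead of using \<open>n - 1\<close> makes the orthogonality
  condition empty for \<open>n = 0\<close>, where truncated subtraction would be wrong.
\<close>

definition ortho_space :: "real ^ ('d option) \<Rightarrow> nat \<Rightarrow> (real ^ 'd::finite \<Rightarrow> real) set" where
  "ortho_space \<kappa> n =
     {p \<in> polys_upto n. \<forall>m<n. \<forall>q \<in> polys_upto m. jacobi_inner \<kappa> p q = 0}"

definition is_reproducing_kernel ::
  "real ^ ('d option) \<Rightarrow> nat \<Rightarrow> (real ^ 'd::finite \<Rightarrow> real ^ 'd \<Rightarrow> real) \<Rightarrow> bool" where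
  "is_reproducing_kernel \<kappa> n P \<longleftrightarrow>
     (\<forall>y. (\<lambda>x. P x y) \<in> ortho_space \<kappa> n) \<and>
     (\<forall>x. (\<lambda>y. P x y) \<in> ortho_space \<kappa> n) \<and>
     (\<forall>Q \<in> ortho_space \<kappa> n. \<forall>x. jacobi_inner \<kappa> (\<lambda>y. P x y) Q = Q x)"

definition jacobi_kernel ::
  "real ^ ('d option) \<Rightarrow> nat \<Rightarrow> real ^ 'd::finite \<Rightarrow> real ^ 'd \<Rightarrow> real" where
  "jacobi_kernel \<kappa> n = (THE P. is_reproducing_kernel \<kappa> n P)"

definition is_ortho_proj ::
  "real ^ ('d option) \<Rightarrow> nat \<Rightarrow> (real ^ 'd::finite \<Rightarrow> real) \<Rightarrow> (real ^ 'd \<Rightarrow> real) \<Rightarrow> bool" where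
  "is_ortho_proj \<kappa> n f r \<longleftrightarrow>
     r \<in> ortho_space \<kappa> n \<and>
     (\<forall>q \<in> ortho_space \<kappa> n. jacobi_inner \<kappa> (\<lambda>x. f x - r x) q = 0)"

definition ortho_proj ::
  "real ^ ('d option) \<Rightarrow> nat \<Rightarrow> (real ^ 'd::finite \<Rightarrow> real) \<Rightarrow> real ^ 'd \<Rightarrow> real" where
  "ortho_proj \<kappa> n f = (THE r. is_ortho_proj \<kappa> n f r)"

definition hcoords :: "real ^ 'd::finite \<Rightarrow> real ^ ('d option)" where
  "hcoords x =
     (\<chi> j. case j of Some i \<Rightarrow> x $ i | None \<Rightarrow> 1 - (\<Sum>i\<in>UNIV. x $ i))"

definition R_proj ::
  "real ^ ('d option) \<Rightarrow> nat \<Rightarrow> ('d option \<Rightarrow> nat) \<Rightarrow> real ^ 'd::finite \<Rightarrow> real" where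
  "R_proj \<kappa> n \<alpha> = ortho_proj \<kappa> n (\<lambda>x. vmonom (hcoords x) \<alpha>)"

end

theory Submission
  imports Defs
begin

text \<open>
  Let \<open>T Q = \<Sum>\<^sub>\<alpha> w\<^sub>\<alpha> X\<^sup>\<alpha> \<langle>X\<^sup>\<alpha>, Q\<rangle>\<close>, summed over \<open>|\<alpha>| = N\<close> with
  \<open>w\<^sub>\<alpha> = 1 / ((\<kappa> + 1)\<^sub>\<alpha> \<alpha>!)\<close>; up to a scalar this is the Bernstein--Durrmeyer operator. By the
  Dirichlet integral, \<open>T x\<^sup>\<beta>\<close> is a sum over \<open>\<alpha>\<close> of \<open>X\<^sup>\<alpha> / \<alpha>!\<close> times a product of Pochhammer
  symbols in \<open>\<alpha>\<close>; expanding these in falling factorials and using the multinomial theorem with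
  \<open>|X| = 1\<close> shows that, for \<open>Q\<close> of degree at most \<open>n\<close>, \<open>T Q - Q / C\<close> has degree less than \<open>n\<close>,
  where \<open>C\<close> is the constant in front of the sum. Projecting \<open>T Q\<close> onto the orthogonal space
  therefore gives \<open>Q / C\<close> for \<open>Q\<close> in that space, and this is the reproducing property of the
  right-hand side.
\<close>

subsection \<open>The Dirichlet integral\<close>

lemma prod_option_UNIV:
  "(\<Prod>j\<in>UNIV. f j) = f None * (\<Prod>i\<in>UNIV. f (Some i :: 'a::finite option))"
  by (simp add: UNIV_option_conv prod.reindex)

lemma sum_option_UNIV:
  "(\<Sum>j\<in>UNIV. f j) = f None + (\<Sum>i\<in>UNIV. f (Some i :: 'a::finite option))"
  by (simp add: UNIV_option_conv sum.reindex)

text \<open>Tonelli over the coordinates. Since \<open>nn_integral_lborel_prod\<close> runs over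
  \<open>Basis\<close>, the factors are reindexed along the injection sending \<open>i\<close> to
  \<open>axis i 1\<close>.\<close>

lemma nn_integral_lborel_vec_prod:
  fixes f :: "'n::finite \<Rightarrow> real \<Rightarrow> real"
  assumes [measurable]: "\<And>i. f i \<in> borel_measurable borel" and nn: "\<And>i x. 0 \<le> f i x"
  shows "(\<integral>\<^sup>+x. ennreal (\<Prod>i\<in>UNIV. f i (x $ i)) \<partial>(lborel :: (real ^ 'n) measure))
    = (\<Prod>i\<in>UNIV. \<integral>\<^sup>+t. ennreal (f i t) \<partial>lborel)"
proof -
  have B: "(Basis :: (real ^ 'n) set) = (\<lambda>i. axis i 1) ` UNIV"
    by (auto simp: Basis_vec_def)
  have inj: "inj (\<lambda>i. axis i (1::real) :: real ^ 'n)"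
    by (auto simp: inj_on_def axis_eq_axis)
  define g where "g b t = ennreal (f (inv (\<lambda>i. axis i (1::real)) b) t)" for b :: "real ^ 'n" and t
  have g: "g (axis i 1) = (\<lambda>t. ennreal (f i t))" for i
    by (simp add: g_def inv_f_f[OF inj] fun_eq_iff)
  have "(\<integral>\<^sup>+x. (\<Prod>b\<in>Basis. g b (x \<bullet> b)) \<partial>lborel) = (\<Prod>b\<in>Basis. (\<integral>\<^sup>+x. g b x \<partial>lborel))"
    by (rule nn_integral_lborel_prod) (auto simp: g_def)
  then show ?thesis
    unfolding B prod.reindex[OF inj]
    by (simp add: g o_def inner_axis prod_ennreal nn)
qed

lemma nn_integral_lborel_scale:
  fixes f :: "'a::euclidean_space \<Rightarrow> ennreal"
  assumes [measurable]: "f \<in> borel_measurable borel" and c: "c > 0"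
  shows "(\<integral>\<^sup>+x. f x \<partial>lborel) = ennreal (c ^ DIM('a)) * (\<integral>\<^sup>+x. f (c *\<^sub>R x) \<partial>lborel)"
  using c by (subst lborel_affine[of c 0])
     (simp_all add: nn_integral_density nn_integral_distr nn_integral_cmult ennreal_power)

lemma simplex_T_measurable [measurable]: "simplex_T \<in> sets borel"
  unfolding simplex_T_def by measurable

lemma jacobi_weight_measurable [measurable]: "jacobi_weight \<kappa> \<in> borel_measurable borel"
  unfolding jacobi_weight_def by measurable

lemma jacobi_weight_nonneg: "jacobi_weight \<kappa> x \<ge> 0"
  unfolding jacobi_weight_def by (intro mult_nonneg_nonneg prod_nonneg) auto

text \<open>
  A product of Gamma integrals in the variables \<open>x\<close> and \<open>s - |x|\<close> is
  evaluated once directly and once by scaling \<open>x\<close> by \<open>s\<close>.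
\<close>

lemma nn_integral_jacobi_weight:
  fixes \<kappa> :: "real ^ ('d::finite option)"
  assumes \<kappa>: "\<And>i. \<kappa> $ i > -1"
  shows "(\<integral>\<^sup>+x. ennreal (indicator simplex_T x * jacobi_weight \<kappa> x) \<partial>lborel)
    = ennreal ((\<Prod>i\<in>UNIV. Gamma (\<kappa> $ i + 1)) / Gamma ((\<Sum>i\<in>UNIV. \<kappa> $ i) + real CARD('d) + 1))"
    (is "?J = _")
proof -
  define A where "A = (\<Sum>i\<in>UNIV. \<kappa> $ i) + real CARD('d) + 1"
  define S :: "real ^ 'd \<Rightarrow> real" where "S x = (\<Sum>i\<in>UNIV. x $ i)" for x
  \<comment> \<open>The indicators in \<open>h\<close> and \<open>k\<close> carry the constraints of
    the simplex: \<open>h x * k (1 - S x)\<close> is the weight restricted to it, and every integral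
    can run over the whole space.\<close>
  define h :: "real ^ 'd \<Rightarrow> real"
    where "h x = (\<Prod>i\<in>UNIV. indicator {0..} (x $ i) * (x $ i) powr (\<kappa> $ Some i))" for x
  define k :: "real \<Rightarrow> real" where "k t = indicator {0..} t * t powr (\<kappa> $ None)" for t
  have [measurable]: "S \<in> borel_measurable borel" "h \<in> borel_measurable borel" "k \<in> borel_measurable borel"
    unfolding S_def h_def k_def by measurable
  have h0: "h x \<ge> 0" for x unfolding h_def by (intro prod_nonneg) auto
  have k0: "k x \<ge> 0" for x unfolding k_def by auto
  have A_sum: "A = (\<Sum>i\<in>UNIV. \<kappa> $ i + 1)"
    by (simp add: A_def sum.distrib)
  have A0: "A > 0" 
  proof -
    have "\<kappa> $ i + 1 > 0" for i using \<kappa>[of i] by simp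
    then show ?thesis unfolding A_sum by (intro sum_pos) auto
  qed
  have gam: "(\<integral>\<^sup>+t. ennreal (indicator {0..} t * t powr (\<kappa> $ i) * exp (-t)) \<partial>lborel) = ennreal (Gamma (\<kappa> $ i + 1))" for i
    using \<kappa>[of i] Gamma_conv_nn_integral_real[of "\<kappa> $ i + 1"] by (simp add: exp_minus field_simps)
  have weight: "indicator simplex_T x * jacobi_weight \<kappa> x = h x * k (1 - S x)" for x
  proof (cases "x \<in> simplex_T")
    case True
    then show ?thesis by (simp add: simplex_T_def h_def k_def S_def jacobi_weight_def)
  next
    case False
    then consider i where "x $ i < 0" | "S x > 1" by (auto simp: simplex_T_def S_def not_le)
    then have "h x * k (1 - S x) = 0"
    proof cases
      case 1
      then have "h x = 0" unfolding h_def by (intro prod_zero bexI[of _ i]) auto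
      then show ?thesis by simp
    qed (simp add: k_def)
    with False show ?thesis by simp
  qed
  \<comment> \<open>Integrating over \<open>s\<close> first, after the shift from \<open>s\<close>
    to \<open>S x + s\<close>, leaves one Gamma integral per coordinate. Integrating over
    \<open>x\<close> first and scaling by \<open>s\<close> leaves a single Gamma integral times
    \<open>?J\<close>.\<close>
  define I where "I = (\<integral>\<^sup>+x. \<integral>\<^sup>+s. ennreal (h x * k (s - S x) * exp (-s)) \<partial>lborel \<partial>lborel)"
  have "I = (\<integral>\<^sup>+x. ennreal (h x * exp (- S x)) * ennreal (Gamma (\<kappa> $ None + 1)) \<partial>lborel)"
    unfolding I_def
  proof (rule nn_integral_cong)
    fix x
    have "(\<integral>\<^sup>+s. ennreal (h x * k (s - S x) * exp (-s)) \<partial>lborel)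
      = (\<integral>\<^sup>+s. ennreal (h x * k s * exp (-(S x + s))) \<partial>lborel)"
      by (subst nn_integral_real_affine[where c=1 and t="S x"]) auto
    also have "\<dots> = (\<integral>\<^sup>+s. ennreal (h x * exp (- S x)) * ennreal (k s * exp (-s)) \<partial>lborel)"
    proof (intro nn_integral_cong)
      fix s
      have "exp (-(S x + s)) = exp (- S x) * exp (- s)" by (simp add: exp_add[symmetric])
      then show "ennreal (h x * k s * exp (-(S x + s))) = ennreal (h x * exp (- S x)) * ennreal (k s * exp (-s))"
        by (simp only:) (simp add: ennreal_mult[symmetric] h0 k0 mult_ac)
    qed
    also have "\<dots> = ennreal (h x * exp (- S x)) * ennreal (Gamma (\<kappa> $ None + 1))"
      by (subst nn_integral_cmult) (simp_all add: k_def gam[symmetric])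
    finally show "(\<integral>\<^sup>+s. ennreal (h x * k (s - S x) * exp (-s)) \<partial>lborel) = ennreal (h x * exp (- S x)) * ennreal (Gamma (\<kappa> $ None + 1))" .
  qed
  also have "\<dots> = (\<integral>\<^sup>+x. ennreal (h x * exp (- S x)) \<partial>lborel) * ennreal (Gamma (\<kappa> $ None + 1))"
    by (rule nn_integral_multc) measurable
  also have "(\<integral>\<^sup>+x. ennreal (h x * exp (- S x)) \<partial>lborel)
    = (\<integral>\<^sup>+x. ennreal (\<Prod>i\<in>UNIV. indicator {0..} (x $ i) * (x $ i) powr (\<kappa> $ Some i) * exp (-(x $ i))) \<partial>lborel)"
    by (simp add: h_def S_def prod.distrib exp_sum sum_negf[symmetric])
  also have "\<dots> = (\<Prod>i\<in>UNIV. ennreal (Gamma (\<kappa> $ Some i + 1)))"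
    by (subst nn_integral_lborel_vec_prod) (simp_all add: gam)
  also have "\<dots> = ennreal (\<Prod>i\<in>UNIV. Gamma (\<kappa> $ Some i + 1))"
    using \<kappa> by (intro prod_ennreal less_imp_le Gamma_real_pos) (smt (verit))
  also have "\<dots> * ennreal (Gamma (\<kappa> $ None + 1)) = ennreal (\<Prod>i\<in>UNIV. Gamma (\<kappa> $ i + 1))"
  proof -
    have "Gamma (\<kappa> $ i + 1) \<ge> 0" for i
      using \<kappa>[of i] by (intro less_imp_le Gamma_real_pos) simp
    then show ?thesis
      by (subst ennreal_mult[symmetric]) (auto simp: prod_option_UNIV mult.commute intro!: prod_nonneg)
  qed
  finally have I1: "I = ennreal (\<Prod>i\<in>UNIV. Gamma (\<kappa> $ i + 1))" .

  have "I = (\<integral>\<^sup>+s. \<integral>\<^sup>+x. ennreal (h x * k (s - S x) * exp (-s)) \<partial>lborel \<partial>lborel)"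
    unfolding I_def by (rule lborel_pair.Fubini') measurable
  also have "\<dots> = (\<integral>\<^sup>+s. ennreal (indicator {0..} s * s powr (A - 1) / exp s) * ?J \<partial>lborel)"
  \<comment> \<open>Only the null set \<open>s = 0\<close> is discarded. For \<open>s < 0\<close>
    both sides vanish, the left one because some coordinate of \<open>x\<close> or
    \<open>s - S x\<close> is negative.\<close>
  proof (rule nn_integral_cong_AE, rule AE_mp[OF AE_lborel_singleton[of 0]], rule AE_I2, rule impI)
    fix s :: real assume s: "s \<noteq> 0"
    show "(\<integral>\<^sup>+x. ennreal (h x * k (s - S x) * exp (-s)) \<partial>lborel) =
      ennreal (indicator {0..} s * s powr (A - 1) / exp s) * ?J"
    proof (cases "s > 0")
      case True
      have hs: "h (s *\<^sub>R x) = s powr (\<Sum>i\<in>UNIV. \<kappa> $ Some i) * h x" for x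
      proof -
        have "h (s *\<^sub>R x) = (\<Prod>i\<in>UNIV. s powr (\<kappa> $ Some i) * (indicator {0..} (x $ i) * (x $ i) powr (\<kappa> $ Some i)))"
          unfolding h_def using True
          by (intro prod.cong) (auto simp: indicator_def powr_mult zero_le_mult_iff)
        then show ?thesis
          using s by (simp add: h_def prod.distrib powr_sum)
      qed
      have ks: "k (s - s * t) = s powr (\<kappa> $ None) * k (1 - t)" for t
      proof -
        have "s - s * t = s * (1 - t)" by (simp add: algebra_simps)
        then show ?thesis using True
          by (auto simp: k_def indicator_def powr_mult zero_le_mult_iff)
      qed
      have Ss: "S (s *\<^sub>R x) = s * S x" for x by (simp add: S_def sum_distrib_left)
      \<comment> \<open>The Jacobian contributes d powers of \<open>s\<close>, and the weight
        contributes the sum of all entries of \<open>\<kappa>\<close>; together the exponent is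
        \<open>A - 1\<close>.\<close>
      have pw: "s ^ CARD('d) * (s powr (\<Sum>i\<in>UNIV. \<kappa> $ Some i) * s powr (\<kappa> $ None)) = s powr (A - 1)"
        using True by (simp add: A_def sum_option_UNIV powr_add powr_realpow)
      have "(\<integral>\<^sup>+x. ennreal (h x * k (s - S x) * exp (-s)) \<partial>lborel)
        = ennreal (s ^ CARD('d)) * (\<integral>\<^sup>+x. ennreal (h (s *\<^sub>R x) * k (s - S (s *\<^sub>R x)) * exp (-s)) \<partial>lborel)"
        by (subst nn_integral_lborel_scale[OF _ True]) (auto simp: DIM_cart)
      also have "\<dots> = ennreal (s ^ CARD('d)) * (\<integral>\<^sup>+x. ennreal (s powr (\<Sum>i\<in>UNIV. \<kappa> $ Some i) * s powr (\<kappa> $ None) * exp (-s))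
            * ennreal (indicator simplex_T x * jacobi_weight \<kappa> x) \<partial>lborel)"
        unfolding weight
        by (intro arg_cong2[where f="(*)"] refl nn_integral_cong)
           (simp add: hs Ss ks ennreal_mult[symmetric] h0 k0 mult_ac)
      also have "\<dots> = ennreal (s ^ CARD('d)) * (ennreal (s powr (\<Sum>i\<in>UNIV. \<kappa> $ Some i) * s powr (\<kappa> $ None) * exp (-s)) * ?J)"
        by (subst nn_integral_cmult) auto
      also have "\<dots> = ennreal (s powr (A - 1) * exp (-s)) * ?J"
        using True by (simp add: pw[symmetric] mult.assoc[symmetric] ennreal_mult[symmetric])
      finally show ?thesis using True by (simp add: exp_minus field_simps)
    next
      case False
      have "h x * k (s - S x) = 0" for x
      proof (cases "\<forall>i. x $ i \<ge> 0")
        case True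
        then have "S x \<ge> 0" by (auto simp: S_def intro: sum_nonneg)
        then show ?thesis using False s by (simp add: k_def)
      next
        case False
        then obtain i where "x $ i < 0" by (auto simp: not_le)
        then have "h x = 0" unfolding h_def by (intro prod_zero bexI[of _ i]) auto
        then show ?thesis by simp
      qed
      then have "ennreal (h x * k (s - S x) * exp (- s)) = 0" for x
        by (simp only: mult_zero_left ennreal_0)
      then show ?thesis using False s by simp
    qed
  qed
  also have "\<dots> = ennreal (Gamma A) * ?J"
    by (subst nn_integral_multc) (simp_all add: Gamma_conv_nn_integral_real[OF A0])
  finally have I2: "ennreal (\<Prod>i\<in>UNIV. Gamma (\<kappa> $ i + 1)) = ennreal (Gamma A) * ?J"
    using I1 by simp
  have G: "Gamma A > 0" using A0 by (rule Gamma_real_pos)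
  have "?J = ennreal (1 / Gamma A) * (ennreal (Gamma A) * ?J)"
    using G by (simp add: mult.assoc[symmetric] ennreal_mult[symmetric])
  also have "\<dots> = ennreal (1 / Gamma A) * ennreal (\<Prod>i\<in>UNIV. Gamma (\<kappa> $ i + 1))"
    unfolding I2 ..
  also have "\<dots> = ennreal ((\<Prod>i\<in>UNIV. Gamma (\<kappa> $ i + 1)) / Gamma A)"
    using G by (simp add: ennreal_mult'[symmetric])
  finally show ?thesis unfolding A_def .
qed

subsection \<open>Leading terms of the Bernstein--Durrmeyer operator\<close>

lemma finite_multi_indices [simp, intro]: "finite {\<beta> :: 'a::finite \<Rightarrow> nat. sum \<beta> UNIV = n}"
  "finite {\<beta> :: 'a::finite \<Rightarrow> nat. sum \<beta> UNIV < n}"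
proof -
  have fin: "finite {\<beta> :: 'a \<Rightarrow> nat. sum \<beta> UNIV \<le> m}" for m
  proof (rule finite_subset)
    show "{\<beta> :: 'a \<Rightarrow> nat. sum \<beta> UNIV \<le> m} \<subseteq> (\<Pi>\<^sub>E i\<in>UNIV. {..m})"
      by (auto simp: PiE_def) (meson finite member_le_sum UNIV_I le_trans zero_le)
  qed (auto intro: finite_PiE)
  show "finite {\<beta> :: 'a \<Rightarrow> nat. sum \<beta> UNIV = n}" "finite {\<beta> :: 'a \<Rightarrow> nat. sum \<beta> UNIV < n}"
    by (auto intro: finite_subset[OF _ fin[of n]])
qed

text \<open>This is m(m-1)...(m-j+1). The case split gives the value 0 for \<open>j > m\<close>,
  where the truncated \<open>m - j\<close> would give \<open>fact m\<close>; the quotient form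
  cancels directly against the factorials of a multi-index.\<close>

definition falling :: "nat \<Rightarrow> nat \<Rightarrow> real" where
  "falling m j = (if j \<le> m then fact m / fact (m - j) else 0)"

lemma falling_0 [simp]: "falling m 0 = 1"
  by (simp add: falling_def)

lemma falling_1: "falling m (Suc 0) = real m"
  by (cases m) (auto simp: falling_def)

lemma falling_Suc: "falling m (Suc j) = (real m - real j) * falling m j"
proof (cases "Suc j \<le> m")
  case True
  then have "m - j = Suc (m - Suc j)" by simp
  then have "fact (m - j) = (real m - real j) * fact (m - Suc j)"
    using True by (simp only: fact_Suc) (simp add: of_nat_diff)
  moreover have "real m - real j \<noteq> 0" using True by simp
  ultimately show ?thesis using True by (simp add: falling_def)
next
  case False
  then show ?thesis by (cases "j = m") (auto simp: falling_def)
qed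

text \<open>As a polynomial in \<open>m\<close>, the Pochhammer symbol is monic of degree
  \<open>b\<close>, so it expands in falling factorials with top coefficient 1. The coefficients may
  depend on \<open>a\<close> and \<open>b\<close> but not on \<open>m\<close>.\<close>

lemma pochhammer_add_nat_falling:
  fixes a :: real
  obtains e where "e b = 1" "\<And>m. pochhammer (a + real m) b = (\<Sum>j\<le>b. e j * falling m j)"
proof (induction b arbitrary: thesis)
  case 0
  show ?case by (rule 0[of "\<lambda>_. 1"]) auto
next
  case (Suc b)
  obtain e where e: "e b = 1" "\<And>m. pochhammer (a + real m) b = (\<Sum>j\<le>b. e j * falling m j)"
    using Suc.IH by blast
  \<comment> \<open>In \<open>a + m + b = (m - j) + (j + a + b)\<close> the first summand raises
    \<open>falling m j\<close> to \<open>falling m (Suc j)\<close>, and the second keeps the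
    index.\<close>
  define e' where "e' j = (if j = 0 then 0 else e (j - 1)) + (if j \<le> b then (real j + a + real b) * e j else 0)" for j
  show ?case
  proof (rule Suc.prems[of e'])
    show "e' (Suc b) = 1" using e(1) by (simp add: e'_def)
    fix m
    have "pochhammer (a + real m) (Suc b) = (\<Sum>j\<le>b. e j * falling m j * (a + real m + real b))"
      by (simp add: pochhammer_Suc e(2) sum_distrib_right)
    also have "\<dots> = (\<Sum>j\<le>b. e j * falling m (Suc j)) + (\<Sum>j\<le>b. (real j + a + real b) * e j * falling m j)"
      unfolding sum.distrib[symmetric] by (intro sum.cong) (auto simp: falling_Suc algebra_simps)
    also have "\<dots> = (\<Sum>j\<le>Suc b. e' j * falling m j)"
    proof -
      have "(\<Sum>j\<le>b. e j * falling m (Suc j)) = (\<Sum>j\<le>Suc b. (if j = 0 then 0 else e (j - 1)) * falling m j)"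
        by (simp add: sum.atMost_Suc_shift del: sum.atMost_Suc)
      moreover have "(\<Sum>j\<le>b. (real j + a + real b) * e j * falling m j)
          = (\<Sum>j\<le>Suc b. (if j \<le> b then (real j + a + real b) * e j else 0) * falling m j)"
        by simp
      ultimately show ?thesis by (simp only: e'_def distrib_right sum.distrib)
    qed
    finally show "pochhammer (a + real m) (Suc b) = (\<Sum>j\<le>Suc b. e' j * falling m j)" .
  qed
qed

text \<open>The homogeneous part of degree \<open>M\<close> of the exponential of the sum of the
  entries of \<open>X\<close>.\<close>

definition exp_term :: "real ^ 'n::finite \<Rightarrow> nat \<Rightarrow> real" where
  "exp_term X M = (\<Sum>\<delta> | sum \<delta> UNIV = M. vmonom X \<delta> / (\<Prod>i\<in>UNIV. fact (\<delta> i)))"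

text \<open>The product of falling factorials divided by \<open>\<alpha>!\<close> is
  \<open>1 / (\<alpha> - \<gamma>)!\<close> if \<open>\<gamma> \<le> \<alpha>\<close> in every
  coordinate, and zero otherwise. The substitution \<open>\<alpha> = \<gamma> + \<delta>\<close>
  then leaves an \<open>exp_term\<close>.\<close>

lemma sum_falling_vmonom:
  fixes X :: "real ^ 'n::finite"
  assumes "sum \<gamma> UNIV \<le> N"
  shows "(\<Sum>\<alpha> | sum \<alpha> UNIV = N. vmonom X \<alpha> / (\<Prod>i\<in>UNIV. fact (\<alpha> i)) * (\<Prod>i\<in>UNIV. falling (\<alpha> i) (\<gamma> i)))
    = vmonom X \<gamma> * exp_term X (N - sum \<gamma> UNIV)"
proof -
  let ?A = "{\<alpha>. sum \<alpha> UNIV = N}" and ?D = "{\<delta>. sum \<delta> UNIV = N - sum \<gamma> UNIV}"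
  let ?f = "\<lambda>\<alpha>. vmonom X \<alpha> / (\<Prod>i\<in>UNIV. fact (\<alpha> i)) * (\<Prod>i\<in>UNIV. falling (\<alpha> i) (\<gamma> i))"
  let ?s = "\<lambda>\<delta> i. \<gamma> i + \<delta> i :: nat"
  have "sum ?f ?A = sum ?f (?s ` ?D)"
  proof (rule sum.mono_neutral_right)
    show "?s ` ?D \<subseteq> ?A" using assms by (auto simp: sum.distrib)
    show "\<forall>\<alpha>\<in>?A - ?s ` ?D. ?f \<alpha> = 0"
    proof
      fix \<alpha> assume \<alpha>: "\<alpha> \<in> ?A - ?s ` ?D"
      have "\<exists>i. \<alpha> i < \<gamma> i"
      proof (rule ccontr)
        assume "\<not> (\<exists>i. \<alpha> i < \<gamma> i)"
        then have le: "\<gamma> i \<le> \<alpha> i" for i by (auto simp: not_less)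
        then have "\<alpha> \<in> ?s ` ?D"
          using \<alpha> by (intro image_eqI[of _ _ "\<lambda>i. \<alpha> i - \<gamma> i"]) (auto simp: sum_subtractf_nat)
        with \<alpha> show False by simp
      qed
      then obtain i where "\<alpha> i < \<gamma> i" ..
      then have "(\<Prod>i\<in>UNIV. falling (\<alpha> i) (\<gamma> i)) = 0"
        by (intro prod_zero bexI[of _ i]) (auto simp: falling_def)
      then show "?f \<alpha> = 0" by simp
    qed
  qed auto
  also have "\<dots> = (\<Sum>\<delta>\<in>?D. ?f (?s \<delta>))"
    by (subst sum.reindex) (auto simp: inj_on_def fun_eq_iff)
  also have "\<dots> = (\<Sum>\<delta>\<in>?D. vmonom X \<gamma> * (vmonom X \<delta> / (\<Prod>i\<in>UNIV. fact (\<delta> i))))"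
  proof (rule sum.cong[OF refl])
    fix \<delta>
    have "(\<Prod>i\<in>UNIV. falling (\<gamma> i + \<delta> i) (\<gamma> i)) = (\<Prod>i\<in>UNIV. fact (\<gamma> i + \<delta> i)) / (\<Prod>i\<in>UNIV. fact (\<delta> i))"
      by (simp add: falling_def prod_dividef)
    moreover have "(\<Prod>i\<in>UNIV. fact (\<gamma> i + \<delta> i) :: real) \<noteq> 0" by simp
    ultimately show "?f (?s \<delta>) = vmonom X \<gamma> * (vmonom X \<delta> / (\<Prod>i\<in>UNIV. fact (\<delta> i)))"
      by (simp add: vmonom_def power_add prod.distrib)
  qed
  finally show ?thesis by (simp add: exp_term_def sum_distrib_left)
qed

text \<open>The multinomial theorem, by applying the Euler operator to \<open>exp_term\<close>.\<close>

lemma exp_term_eq: "exp_term X M = (\<Sum>i\<in>UNIV. X $ i) ^ M / fact M"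
proof (induction M)
  case 0
  have "{\<delta> :: 'a \<Rightarrow> nat. sum \<delta> UNIV = 0} = {\<lambda>_. 0}" by (auto simp: fun_eq_iff)
  then show ?case by (simp add: exp_term_def vmonom_def)
next
  case (Suc M)
  have unit: "sum (\<lambda>j. if j = i then Suc 0 else 0) UNIV = 1" for i :: 'a by simp
  \<comment> \<open>The factor \<open>Suc M\<close> is the total degree of each
    \<open>\<delta>\<close>, so it splits into a sum over the coordinates.\<close>
  have "real (Suc M) * exp_term X (Suc M) =
     (\<Sum>\<delta> | sum \<delta> UNIV = Suc M. \<Sum>i\<in>UNIV. vmonom X \<delta> / (\<Prod>i\<in>UNIV. fact (\<delta> i)) * real (\<delta> i))"
    unfolding exp_term_def sum_distrib_left
  proof (intro sum.cong refl)
    fix \<delta> :: "'a \<Rightarrow> nat" assume "\<delta> \<in> {\<delta>. sum \<delta> UNIV = Suc M}"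
    then have "real (Suc M) = (\<Sum>i\<in>UNIV. real (\<delta> i))" by (simp flip: of_nat_sum)
    then show "real (Suc M) * (vmonom X \<delta> / (\<Prod>i\<in>UNIV. fact (\<delta> i)))
        = (\<Sum>i\<in>UNIV. vmonom X \<delta> / (\<Prod>i\<in>UNIV. fact (\<delta> i)) * real (\<delta> i))"
      by (simp add: sum_distrib_left sum_divide_distrib mult.commute)
  qed
  also have "\<dots> = (\<Sum>i\<in>UNIV. \<Sum>\<delta> | sum \<delta> UNIV = Suc M. vmonom X \<delta> / (\<Prod>i\<in>UNIV. fact (\<delta> i)) * real (\<delta> i))"
    by (rule sum.swap)
  also have "\<dots> = (\<Sum>i\<in>UNIV. X $ i * exp_term X M)"
  proof (rule sum.cong[OF refl])
    fix i :: 'a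
    \<comment> \<open>For the unit multi-index at \<open>i\<close>, the sum in
      \<open>sum_falling_vmonom\<close> is \<open>X $ i\<close> times the partial derivative in
      direction \<open>i\<close>.\<close>
    let ?e = "\<lambda>j. if j = i then Suc 0 else 0"
    have "falling (\<delta> j) (?e j) = (if j = i then real (\<delta> j) else 1)" for \<delta> :: "'a \<Rightarrow> nat" and j
      by (simp add: falling_1)
    then have "(\<Prod>j\<in>UNIV. falling (\<delta> j) (?e j)) = real (\<delta> i)" for \<delta> :: "'a \<Rightarrow> nat"
      by simp
    moreover have "vmonom X ?e = X $ i"
    proof -
      have "(X $ j) ^ ?e j = (if j = i then X $ j else 1)" for j by simp
      then show ?thesis by (simp add: vmonom_def)
    qed
    ultimately show "(\<Sum>\<delta> | sum \<delta> UNIV = Suc M. vmonom X \<delta> / (\<Prod>i\<in>UNIV. fact (\<delta> i)) * real (\<delta> i)) = X $ i * exp_term X M"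
      using sum_falling_vmonom[of ?e "Suc M" X] by simp
  qed
  also have "\<dots> = (\<Sum>i\<in>UNIV. X $ i) ^ Suc M / fact M"
    by (simp add: Suc sum_distrib_right sum_divide_distrib)
  finally have "exp_term X (Suc M) = (\<Sum>i\<in>UNIV. X $ i) ^ Suc M / fact M / real (Suc M)"
    by (simp add: nonzero_eq_divide_eq mult_ac del: of_nat_Suc)
  then show ?case by (simp add: mult.commute)
qed

section \<open>Polynomials of bounded degree\<close>

text \<open>With a strict bound, \<open>poly_lt 0\<close> is the zero space, so "degree at most n -
  1" is \<open>poly_lt n\<close> for every \<open>n\<close>, including 0.\<close>

definition poly_lt :: "nat \<Rightarrow> (real ^ 'd::finite \<Rightarrow> real) set" where
  "poly_lt n = {p. \<exists>c. \<forall>x. p x = (\<Sum>\<beta> | sum \<beta> UNIV < n. c \<beta> * vmonom x \<beta>)}"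

lemma polys_upto_eq: "polys_upto n = poly_lt (Suc n)"
  by (simp add: polys_upto_def poly_lt_def less_Suc_eq_le)

lemma poly_lt_cmult: "p \<in> poly_lt n \<Longrightarrow> (\<lambda>x. c * p x) \<in> poly_lt n"
proof -
  assume "p \<in> poly_lt n"
  then obtain e where "\<And>x. p x = (\<Sum>\<beta> | sum \<beta> UNIV < n. e \<beta> * vmonom x \<beta>)"
    by (auto simp: poly_lt_def)
  then show ?thesis
    unfolding poly_lt_def by (auto simp: sum_distrib_left mult.assoc intro!: exI[of _ "\<lambda>\<beta>. c * e \<beta>"])
qed

lemma poly_lt_add: "p \<in> poly_lt n \<Longrightarrow> q \<in> poly_lt n \<Longrightarrow> (\<lambda>x. p x + q x) \<in> poly_lt n"
proof -
  assume "p \<in> poly_lt n" "q \<in> poly_lt n"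
  then obtain e e' where "\<And>x. p x = (\<Sum>\<beta> | sum \<beta> UNIV < n. e \<beta> * vmonom x \<beta>)"
      "\<And>x. q x = (\<Sum>\<beta> | sum \<beta> UNIV < n. e' \<beta> * vmonom x \<beta>)"
    by (auto simp: poly_lt_def)
  then show ?thesis
    unfolding poly_lt_def by (auto simp: sum.distrib distrib_right intro!: exI[of _ "\<lambda>\<beta>. e \<beta> + e' \<beta>"])
qed

lemma poly_lt_0: "(\<lambda>x. 0) \<in> poly_lt n"
  by (auto simp: poly_lt_def intro!: exI[of _ "\<lambda>_. 0"])

lemma poly_lt_diff: "p \<in> poly_lt n \<Longrightarrow> q \<in> poly_lt n \<Longrightarrow> (\<lambda>x. p x - q x) \<in> poly_lt n"
  using poly_lt_add[of p n "\<lambda>x. (-1) * q x"] poly_lt_cmult[of q n "-1"] by simp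

lemma poly_lt_sum: "(\<And>i. i \<in> I \<Longrightarrow> p i \<in> poly_lt n) \<Longrightarrow> (\<lambda>x. \<Sum>i\<in>I. p i x) \<in> poly_lt n"
  by (induction I rule: infinite_finite_induct) (auto intro: poly_lt_0 poly_lt_add)

lemma poly_lt_vmonom: "sum \<beta> UNIV < n \<Longrightarrow> (\<lambda>x. vmonom x \<beta>) \<in> poly_lt n"
proof -
  assume "sum \<beta> UNIV < n"
  moreover have "(if \<gamma> = \<beta> then 1 else 0) * vmonom x \<gamma> = (if \<gamma> = \<beta> then vmonom x \<gamma> else 0)" for \<gamma> x
    by simp
  ultimately show ?thesis
    unfolding poly_lt_def by (auto intro!: exI[of _ "\<lambda>\<gamma>. if \<gamma> = \<beta> then 1 else 0"])
qed

lemma poly_lt_mono: "m \<le> n \<Longrightarrow> p \<in> poly_lt m \<Longrightarrow> p \<in> poly_lt n"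
proof -
  assume "m \<le> n" "p \<in> poly_lt m"
  then obtain e where p: "p = (\<lambda>x. \<Sum>\<beta> | sum \<beta> UNIV < m. e \<beta> * vmonom x \<beta>)"
    by (auto simp: poly_lt_def)
  show ?thesis unfolding p using \<open>m \<le> n\<close>
    by (intro poly_lt_sum poly_lt_cmult poly_lt_vmonom) auto
qed

text \<open>Exponent 0 at position \<open>None\<close> turns an ordinary monomial into one in the
  homogeneous coordinates, so that formulas for \<open>hcoords\<close> apply to it.\<close>

definition ext0 :: "('d \<Rightarrow> nat) \<Rightarrow> 'd option \<Rightarrow> nat" where
  "ext0 \<beta> j = (case j of None \<Rightarrow> 0 | Some i \<Rightarrow> \<beta> i)"

lemma ext0_simps [simp]: "ext0 \<beta> None = 0" "ext0 \<beta> (Some i) = \<beta> i"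
  by (simp_all add: ext0_def)

lemma vmonom_hcoords_ext0: "vmonom (hcoords x) (ext0 \<beta>) = vmonom x \<beta>"
  by (simp add: vmonom_def prod_option_UNIV hcoords_def)

lemma sum_ext0: "sum (ext0 \<beta>) UNIV = sum \<beta> (UNIV :: 'd::finite set)"
  by (simp add: sum_option_UNIV)

text \<open>This collapses \<open>exp_term (hcoords x) M\<close> to the constant
  \<open>1 / fact M\<close>.\<close>

lemma sum_hcoords: "(\<Sum>i\<in>UNIV. hcoords x $ i) = 1"
  by (simp add: sum_option_UNIV hcoords_def)

text \<open>
  Only the top falling factorial in the expansion of each Pochhammer symbol contributes in degree
  \<open>|\<beta>|\<close>.
\<close>

lemma durrmeyer_leading_term:
  fixes a :: "'d::finite option \<Rightarrow> real"
  assumes le: "sum \<beta> UNIV \<le> N"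
  shows "(\<lambda>x::real^'d. (\<Sum>\<alpha> | sum \<alpha> UNIV = N. vmonom (hcoords x) \<alpha> / (\<Prod>i\<in>UNIV. fact (\<alpha> i))
      * (\<Prod>i\<in>UNIV. pochhammer (a i + real (\<alpha> i)) (ext0 \<beta> i))) - vmonom x \<beta> / fact (N - sum \<beta> UNIV))
    \<in> poly_lt (sum \<beta> UNIV)"
proof -
  have "\<exists>e. e (\<beta> i) = 1 \<and> (\<forall>m. pochhammer (a (Some i) + real m) (\<beta> i) = (\<Sum>j\<le>\<beta> i. e j * falling m j))" for i
    by (rule pochhammer_add_nat_falling[of "\<beta> i" "a (Some i)"]) blast
  then obtain e where e1: "\<And>i. e i (\<beta> i) = 1"
    and e: "\<And>i m. pochhammer (a (Some i) + real m) (\<beta> i) = (\<Sum>j\<le>\<beta> i. e i j * falling m j)"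
    by metis
  let ?P = "\<Pi>\<^sub>E i\<in>UNIV. {..\<beta> i}"
  have finP: "finite ?P" by (auto intro: finite_PiE)
  have bP: "\<beta> \<in> ?P" by auto
  \<comment> \<open>The factor \<open>1 / fact (N - sum \<gamma> UNIV)\<close> is the value of
    \<open>exp_term\<close> at \<open>hcoords x\<close>. At \<open>\<gamma> = \<beta>\<close> all
    the top coefficients \<open>e i (\<beta> i)\<close> are 1, which gives exactly the subtracted
    term.\<close>
  define c where "c \<gamma> = (\<Prod>i\<in>UNIV. e i (\<gamma> i)) / fact (N - sum \<gamma> UNIV)" for \<gamma>
  have sub: "sum \<gamma> UNIV \<le> sum \<beta> UNIV" if "\<gamma> \<in> ?P" for \<gamma>
    using that by (intro sum_mono) auto
  have poch: "(\<Prod>i\<in>UNIV. pochhammer (a i + real (\<alpha> i)) (ext0 \<beta> i))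
      = (\<Sum>\<gamma>\<in>?P. (\<Prod>i\<in>UNIV. e i (\<gamma> i)) * (\<Prod>i\<in>UNIV. falling (\<alpha> i) (ext0 \<gamma> i)))" for \<alpha>
  proof -
    have "(\<Prod>i\<in>UNIV. pochhammer (a i + real (\<alpha> i)) (ext0 \<beta> i)) = (\<Prod>i\<in>UNIV. \<Sum>j\<le>\<beta> i. e i j * falling (\<alpha> (Some i)) j)"
      by (simp add: prod_option_UNIV e)
    also have "\<dots> = (\<Sum>\<gamma>\<in>?P. \<Prod>i\<in>UNIV. e i (\<gamma> i) * falling (\<alpha> (Some i)) (\<gamma> i))"
      by (rule prod_sum_PiE) auto
    finally show ?thesis by (simp add: prod_option_UNIV prod.distrib)
  qed
  have "(\<Sum>\<alpha> | sum \<alpha> UNIV = N. vmonom (hcoords x) \<alpha> / (\<Prod>i\<in>UNIV. fact (\<alpha> i))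
      * (\<Prod>i\<in>UNIV. pochhammer (a i + real (\<alpha> i)) (ext0 \<beta> i))) = (\<Sum>\<gamma>\<in>?P. c \<gamma> * vmonom x \<gamma>)" for x :: "real ^ 'd"
  proof -
    have "(\<Sum>\<alpha> | sum \<alpha> UNIV = N. vmonom (hcoords x) \<alpha> / (\<Prod>i\<in>UNIV. fact (\<alpha> i))
      * (\<Prod>i\<in>UNIV. pochhammer (a i + real (\<alpha> i)) (ext0 \<beta> i)))
      = (\<Sum>\<gamma>\<in>?P. \<Sum>\<alpha> | sum \<alpha> UNIV = N. (\<Prod>i\<in>UNIV. e i (\<gamma> i)) *
          (vmonom (hcoords x) \<alpha> / (\<Prod>i\<in>UNIV. fact (\<alpha> i)) * (\<Prod>i\<in>UNIV. falling (\<alpha> i) (ext0 \<gamma> i))))"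
      unfolding poch sum_distrib_left by (subst sum.swap) (simp add: mult_ac)
    also have "\<dots> = (\<Sum>\<gamma>\<in>?P. c \<gamma> * vmonom x \<gamma>)"
    proof (rule sum.cong[OF refl])
      fix \<gamma> assume "\<gamma> \<in> ?P"
      then have "sum (ext0 \<gamma>) UNIV \<le> N" using sub[of \<gamma>] le by (simp add: sum_ext0)
      from sum_falling_vmonom[OF this, of "hcoords x"]
      show "(\<Sum>\<alpha> | sum \<alpha> UNIV = N. (\<Prod>i\<in>UNIV. e i (\<gamma> i)) *
          (vmonom (hcoords x) \<alpha> / (\<Prod>i\<in>UNIV. fact (\<alpha> i)) * (\<Prod>i\<in>UNIV. falling (\<alpha> i) (ext0 \<gamma> i)))) = c \<gamma> * vmonom x \<gamma>"
        unfolding sum_distrib_left[symmetric]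
        by (simp only:) (simp add: exp_term_eq sum_hcoords sum_ext0 vmonom_hcoords_ext0 c_def)
    qed
    finally show ?thesis .
  qed
  moreover have "(\<Sum>\<gamma>\<in>?P. c \<gamma> * vmonom x \<gamma>) - vmonom x \<beta> / fact (N - sum \<beta> UNIV) = (\<Sum>\<gamma>\<in>?P - {\<beta>}. c \<gamma> * vmonom x \<gamma>)"
    for x :: "real ^ 'd"
    using sum.remove[OF finP bP, of "\<lambda>\<gamma>. c \<gamma> * vmonom x \<gamma>"] by (simp add: c_def e1)
  \<comment> \<open>A multi-index of the box other than its corner \<open>\<beta>\<close> has
    strictly smaller total degree.\<close>
  moreover have "(\<lambda>x :: real ^ 'd. \<Sum>\<gamma>\<in>?P - {\<beta>}. c \<gamma> * vmonom x \<gamma>) \<in> poly_lt (sum \<beta> UNIV)"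
  proof (intro poly_lt_sum poly_lt_cmult poly_lt_vmonom)
    fix \<gamma> assume \<gamma>: "\<gamma> \<in> ?P - {\<beta>}"
    then have le': "\<gamma> i \<le> \<beta> i" for i by auto
    from \<gamma> obtain i where "\<gamma> i \<noteq> \<beta> i" by auto
    with le' have "\<gamma> i < \<beta> i" by (simp add: le_neq_implies_less)
    with le' show "sum \<gamma> UNIV < sum \<beta> UNIV" by (intro sum_strict_mono_ex1) auto
  qed
  ultimately show ?thesis by simp
qed

subsection \<open>The Jacobi inner product\<close>

text \<open>On the line from \<open>u\<close> to \<open>y\<close>, \<open>p\<close> becomes a
  univariate polynomial that vanishes on an open set containing \<open>t = 0\<close>. It has
  infinitely many roots, so its coefficients are zero; at \<open>t = 1\<close> its value is
  \<open>p y\<close>.\<close>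

lemma real_polynomial_function_open_zero:
  fixes p :: "'a::real_normed_vector \<Rightarrow> real"
  assumes p: "real_polynomial_function p" and U: "open U" "u \<in> U" and z: "\<And>x. x \<in> U \<Longrightarrow> p x = 0"
  shows "p y = 0"
proof -
  define f where "f t = u + t *\<^sub>R (y - u)" for t :: real
  have "polynomial_function f"
    unfolding f_def
    by (intro polynomial_function_add polynomial_function_const polynomial_function_bounded_linear
        bounded_linear_scaleR_left)
  then have "real_polynomial_function (p \<circ> f)"
    using p by (rule real_polynomial_function_compose)
  then obtain a n where an: "p \<circ> f = (\<lambda>t. \<Sum>i\<le>n. a i * t ^ i)"
    using real_polynomial_function_imp_sum by blast
  have "open (f -` U)"
    unfolding f_def by (intro open_vimage U continuous_intros)
  moreover have "0 \<in> f -` U" using U by (simp add: f_def)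
  ultimately have "infinite (f -` U)"
    using finite_imp_not_open by blast
  moreover have "f -` U \<subseteq> {t. (\<Sum>i\<le>n. a i * t ^ i) = 0}"
  proof
    fix t assume "t \<in> f -` U"
    then have "(p \<circ> f) t = 0" using z by simp
    then show "t \<in> {t. (\<Sum>i\<le>n. a i * t ^ i) = 0}" by (simp add: an)
  qed
  ultimately have "infinite {t. (\<Sum>i\<le>n. a i * t ^ i) = 0}"
    using finite_subset by blast
  then have "\<forall>i\<le>n. a i = 0"
    using Transcendental.polyfun_finite_roots[where c=a and n=n] by blast
  then have "(p \<circ> f) 1 = 0" by (simp add: an)
  then show ?thesis by (simp add: f_def)
qed

lemma real_polynomial_function_vmonom: "real_polynomial_function (\<lambda>x. vmonom x \<beta>)"
  unfolding vmonom_def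
  by (intro real_polynomial_function_prod real_polynomial_function_power
      real_polynomial_function.intros(1) bounded_linear_vec_nth) auto

lemma real_polynomial_function_vmonom_hcoords: "real_polynomial_function (\<lambda>x. vmonom (hcoords x) \<alpha>)"
proof -
  have "real_polynomial_function (\<lambda>x::real^'a. hcoords x $ i)" for i
  proof (cases i)
    case None
    then show ?thesis
      by (simp add: hcoords_def)
         (intro real_polynomial_function_diff real_polynomial_function.intros(2)
           real_polynomial_function_sum real_polynomial_function.intros(1) bounded_linear_vec_nth finite)
  qed (simp add: hcoords_def real_polynomial_function.intros(1) bounded_linear_vec_nth)
  then show ?thesis
    unfolding vmonom_def by (intro real_polynomial_function_prod real_polynomial_function_power) auto
qed

lemma real_polynomial_function_poly_lt: "p \<in> poly_lt n \<Longrightarrow> real_polynomial_function p"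
proof -
  assume "p \<in> poly_lt n"
  then obtain e where "p = (\<lambda>x. \<Sum>\<beta> | sum \<beta> UNIV < n. e \<beta> * vmonom x \<beta>)"
    by (auto simp: poly_lt_def)
  then show ?thesis
    by (auto intro!: real_polynomial_function_sum real_polynomial_function.intros(4) real_polynomial_function.intros(2)
        real_polynomial_function_vmonom)
qed

text \<open>The spaces \<open>poly_lt (Suc m)\<close> with \<open>m < n\<close> are nested, and the
  largest is \<open>poly_lt n\<close>. For \<open>n = 0\<close> one condition is vacuous and the
  other only tests the zero function.\<close>

lemma ortho_space_iff:
  "p \<in> ortho_space \<kappa> n \<longleftrightarrow> p \<in> poly_lt (Suc n) \<and> (\<forall>q\<in>poly_lt n. jacobi_inner \<kappa> p q = 0)"
proof -
  have "(\<forall>m<n. \<forall>q\<in>poly_lt (Suc m). jacobi_inner \<kappa> p q = 0) \<longleftrightarrow> (\<forall>q\<in>poly_lt n. jacobi_inner \<kappa> p q = 0)"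
  proof (cases n)
    case 0
    have "q = (\<lambda>_. 0)" if "q \<in> poly_lt 0" for q :: "real ^ 'a \<Rightarrow> real"
      using that by (auto simp: poly_lt_def)
    moreover have "jacobi_inner \<kappa> p (\<lambda>_. 0) = 0"
      by (simp add: jacobi_inner_def set_lebesgue_integral_def)
    ultimately show ?thesis using 0 by auto
  next
    case (Suc m)
    then show ?thesis by (meson Suc_leI lessI poly_lt_mono)
  qed
  then show ?thesis by (simp add: ortho_space_def polys_upto_eq)
qed

lemma jacobi_inner_commute: "jacobi_inner \<kappa> f g = jacobi_inner \<kappa> g f"
  by (simp add: jacobi_inner_def mult.commute)

lemma jacobi_inner_cmult_left: "jacobi_inner \<kappa> (\<lambda>x. c * f x) g = c * jacobi_inner \<kappa> f g"
  by (simp add: jacobi_inner_def mult.assoc)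

context
  fixes \<kappa> :: "real ^ ('d::finite option)"
  assumes \<kappa>: "\<And>i. \<kappa> $ i > -1"
begin

lemma norm_const_pos: "(\<Sum>i\<in>UNIV. \<kappa> $ i) + real CARD('d) + 1 > 0"
proof -
  have "\<kappa> $ i + 1 > 0" for i using \<kappa>[of i] by simp
  then have "(\<Sum>i\<in>UNIV. \<kappa> $ i + 1) > 0" by (intro sum_pos) auto
  then show ?thesis by (simp add: sum.distrib add_ac)
qed

lemma prod_Gamma_pos: "(\<Prod>i\<in>UNIV. Gamma (\<kappa> $ i + 1)) > 0"
proof -
  have "\<kappa> $ i + 1 > 0" for i using \<kappa>[of i] by simp
  then show ?thesis by (intro prod_pos ballI Gamma_real_pos)
qed

text \<open>Both follow from the value of the nonnegative integral, which is finite. The context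
  ends here so that these facts can also be applied to shifted parameter vectors, as in
  \<open>jacobi_moment\<close>.\<close>

lemma set_integrable_jacobi_weight: "set_integrable lborel simplex_T (jacobi_weight \<kappa>)"
  and integral_jacobi_weight: "(LINT x:simplex_T|lborel. jacobi_weight \<kappa> x)
    = (\<Prod>i\<in>UNIV. Gamma (\<kappa> $ i + 1)) / Gamma ((\<Sum>i\<in>UNIV. \<kappa> $ i) + real CARD('d) + 1)"
proof -
  have nn: "AE x in lborel. 0 \<le> indicator simplex_T x * jacobi_weight \<kappa> x"
    by (simp add: jacobi_weight_nonneg)
  show "set_integrable lborel simplex_T (jacobi_weight \<kappa>)"
    unfolding set_integrable_def real_scaleR_def
    using nn by (intro integrableI_nonneg) (simp_all add: nn_integral_jacobi_weight[OF \<kappa>])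
  have "Gamma ((\<Sum>i\<in>UNIV. \<kappa> $ i) + real CARD('d) + 1) > 0"
    using norm_const_pos by (rule Gamma_real_pos)
  then show "(LINT x:simplex_T|lborel. jacobi_weight \<kappa> x)
    = (\<Prod>i\<in>UNIV. Gamma (\<kappa> $ i + 1)) / Gamma ((\<Sum>i\<in>UNIV. \<kappa> $ i) + real CARD('d) + 1)"
    unfolding set_lebesgue_integral_def real_scaleR_def
    using nn prod_Gamma_pos by (subst integral_eq_nn_integral) (simp_all add: nn_integral_jacobi_weight[OF \<kappa>])
qed

end

section \<open>The inner product on polynomial functions\<close>

context
  fixes \<kappa> :: "real ^ ('d::finite option)"
  assumes \<kappa>: "\<And>i. \<kappa> $ i > -1"
begin

text \<open>The simplex lies in the compact unit cube, so \<open>p\<close> is bounded on it and a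
  multiple of the weight dominates the integrand.\<close>

lemma set_integrable_poly_weight:
  assumes p: "real_polynomial_function p"
  shows "set_integrable lborel simplex_T (\<lambda>x. p x * jacobi_weight \<kappa> x)"
proof -
  have cont: "continuous_on S p" for S
    using continuous_real_polymonial_function[OF p] by (simp add: continuous_at_imp_continuous_on)
  have [measurable]: "p \<in> borel_measurable borel"
    using cont by (rule borel_measurable_continuous_onI)
  have "simplex_T \<subseteq> cbox (0::real^'d) 1"
  proof
    fix x :: "real ^ 'd" assume x: "x \<in> simplex_T"
    have "x $ i \<le> 1" for i
    proof -
      have "x $ i \<le> (\<Sum>i\<in>UNIV. x $ i)" using x by (intro member_le_sum) (auto simp: simplex_T_def)
      then show ?thesis using x by (simp add: simplex_T_def)
    qed
    then show "x \<in> cbox 0 1" using x by (auto simp: mem_box_cart simplex_T_def)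
  qed
  moreover have "bounded (p ` cbox 0 1)"
    by (intro compact_imp_bounded compact_continuous_image cont compact_cbox)
  ultimately obtain M where M: "\<And>x. x \<in> simplex_T \<Longrightarrow> \<bar>p x\<bar> \<le> M"
    unfolding bounded_iff by (metis image_eqI real_norm_def subsetD)
  have "integrable lborel (\<lambda>x. M * (indicator simplex_T x * jacobi_weight \<kappa> x))"
    using set_integrable_jacobi_weight[OF \<kappa>] by (simp add: set_integrable_def)
  then show ?thesis
    unfolding set_integrable_def
  proof (rule Bochner_Integration.integrable_bound)
    show "AE x in lborel. norm (indicat_real simplex_T x *\<^sub>R (p x * jacobi_weight \<kappa> x))
        \<le> norm (M * (indicat_real simplex_T x * jacobi_weight \<kappa> x))"
    proof (rule AE_I2)
      fix x
      show "norm (indicat_real simplex_T x *\<^sub>R (p x * jacobi_weight \<kappa> x))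
        \<le> norm (M * (indicat_real simplex_T x * jacobi_weight \<kappa> x))"
      proof (cases "x \<in> simplex_T")
        case True
        then show ?thesis
          using M[OF True] by (auto simp: abs_mult intro!: mult_right_mono)
      qed simp
    qed
  qed measurable
qed

lemma jacobi_inner_add_left:
  assumes "real_polynomial_function f" "real_polynomial_function f'" "real_polynomial_function g"
  shows "jacobi_inner \<kappa> (\<lambda>x. f x + f' x) g = jacobi_inner \<kappa> f g + jacobi_inner \<kappa> f' g"
  unfolding jacobi_inner_def distrib_left[symmetric] distrib_right
  by (subst set_integral_add(2)) (auto intro!: set_integrable_poly_weight real_polynomial_function.intros(4) assms)

lemma jacobi_inner_diff_left:
  assumes "real_polynomial_function f" "real_polynomial_function f'" "real_polynomial_function g"
  shows "jacobi_inner \<kappa> (\<lambda>x. f x - f' x) g = jacobi_inner \<kappa> f g - jacobi_inner \<kappa> f' g"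
  using jacobi_inner_add_left[of f "\<lambda>x. (-1) * f' x" g] assms jacobi_inner_cmult_left[of \<kappa> "-1" f' g]
    real_polynomial_function.intros(4)[OF real_polynomial_function.intros(2)[of "-1"] assms(2)]
  by simp

lemma jacobi_inner_sum_left:
  assumes "finite I" "\<And>i. i \<in> I \<Longrightarrow> real_polynomial_function (f i)" "real_polynomial_function g"
  shows "jacobi_inner \<kappa> (\<lambda>x. \<Sum>i\<in>I. c i * f i x) g = (\<Sum>i\<in>I. c i * jacobi_inner \<kappa> (f i) g)"
  using assms
proof (induction I rule: finite_induct)
  case empty
  then show ?case by (simp add: jacobi_inner_def set_lebesgue_integral_def)
next
  case (insert i I)
  have "jacobi_inner \<kappa> (\<lambda>x. \<Sum>i\<in>insert i I. c i * f i x) g =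
    jacobi_inner \<kappa> (\<lambda>x. c i * f i x + (\<Sum>i\<in>I. c i * f i x)) g"
    using insert.hyps by simp
  also have "\<dots> = jacobi_inner \<kappa> (\<lambda>x. c i * f i x) g + jacobi_inner \<kappa> (\<lambda>x. \<Sum>i\<in>I. c i * f i x) g"
    using insert by (intro jacobi_inner_add_left) (auto intro!: real_polynomial_function_sum)
  finally show ?case using insert by (simp add: jacobi_inner_cmult_left)
qed

text \<open>The nonnegative integrand has integral zero, so it vanishes almost everywhere. On the
  open simplex \<open>U\<close> the weight is positive; hence the open set where \<open>p\<close> is
  nonzero in \<open>U\<close> is null, therefore empty, and \<open>p\<close> vanishes
  identically.\<close>

lemma jacobi_inner_definite:
  assumes p: "real_polynomial_function p" and z: "jacobi_inner \<kappa> p p = 0"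
  shows "p = (\<lambda>_. 0)"
proof
  fix y
  define U where "U = {x :: real ^ 'd. (\<forall>i. 0 < x $ i) \<and> (\<Sum>i\<in>UNIV. x $ i) < 1}"
  have cont: "continuous_on S p" for S
    using continuous_real_polymonial_function[OF p] by (simp add: continuous_at_imp_continuous_on)
  have U: "open U"
  proof -
    have "U = (\<Inter>i. {x. 0 < x $ i}) \<inter> {x. (\<Sum>i\<in>UNIV. x $ i) < 1}" by (auto simp: U_def)
    also have "open \<dots>"
      by (intro open_Int open_INT ballI open_Collect_less continuous_intros) auto
    finally show ?thesis .
  qed
  have V: "open (U \<inter> {x. p x \<noteq> 0})"
    by (intro open_Int U open_Collect_neq cont continuous_intros)
  have "Gamma ((\<Sum>i\<in>UNIV. \<kappa> $ i) + real CARD('d) + 1) / (\<Prod>i\<in>UNIV. Gamma (\<kappa> $ i + 1)) \<noteq> 0"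
    using prod_Gamma_pos[OF \<kappa>] Gamma_real_pos[OF norm_const_pos[OF \<kappa>]]
    by (metis divide_pos_pos less_irrefl)
  then have "(LINT x|lborel. indicator simplex_T x *\<^sub>R (p x * p x * jacobi_weight \<kappa> x)) = 0"
    using z unfolding jacobi_inner_def set_lebesgue_integral_def by simp
  moreover have "integrable lborel (\<lambda>x. indicator simplex_T x *\<^sub>R (p x * p x * jacobi_weight \<kappa> x))"
    using set_integrable_poly_weight[OF real_polynomial_function.intros(4)[OF p p]] by (simp add: set_integrable_def)
  ultimately have "AE x in lborel. indicator simplex_T x *\<^sub>R (p x * p x * jacobi_weight \<kappa> x) = 0"
    by (subst (asm) integral_nonneg_eq_0_iff_AE) (auto simp: jacobi_weight_nonneg)
  then have "AE x in lborel. x \<notin> U \<inter> {x. p x \<noteq> 0}"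
  proof eventually_elim
    case (elim x)
    show ?case
    proof
      assume x: "x \<in> U \<inter> {x. p x \<noteq> 0}"
      then have "x \<in> simplex_T" by (auto simp: U_def simplex_T_def less_imp_le)
      moreover have "jacobi_weight \<kappa> x > 0"
        using x unfolding jacobi_weight_def U_def by (auto intro!: mult_pos_pos prod_pos) (metis less_irrefl)+
      ultimately show False using elim x by auto
    qed
  qed
  then have "U \<inter> {x. p x \<noteq> 0} \<in> null_sets lborel"
    using V AE_iff_null_sets[of "U \<inter> {x. p x \<noteq> 0}" lborel] by (simp add: borel_open)
  then have "negligible (U \<inter> {x. p x \<noteq> 0})"
    by (simp add: negligible_iff_null_sets null_sets_completionI)
  then have "U \<inter> {x. p x \<noteq> 0} = {}"
    using V open_not_negligible by blast
  then have "\<And>x. x \<in> U \<Longrightarrow> p x = 0" by auto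
  \<comment> \<open>The barycentre of the simplex witnesses that \<open>U\<close> is
    nonempty.\<close>
  moreover have "(\<chi> i. 1 / (real CARD('d) + 1)) \<in> U"
    by (auto simp: U_def add_pos_pos)
  ultimately show "p y = 0"
    using real_polynomial_function_open_zero[OF p U] by blast
qed

text \<open>On the simplex, the two monomials times the weight are again a Jacobi weight, with
  parameter \<open>\<kappa> + \<alpha> + \<beta>\<close>. The ratio of the two Dirichlet integrals
  is a quotient of Pochhammer symbols.\<close>

lemma jacobi_moment:
  "jacobi_inner \<kappa> (\<lambda>x. vmonom (hcoords x) \<alpha>) (\<lambda>x. vmonom (hcoords x) \<beta>)
   = (\<Prod>i\<in>UNIV. pochhammer (\<kappa> $ i + 1) (\<alpha> i + \<beta> i))
     / pochhammer ((\<Sum>i\<in>UNIV. \<kappa> $ i) + real CARD('d) + 1) (sum \<alpha> UNIV + sum \<beta> UNIV)"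
proof -
  define \<kappa>' :: "real ^ ('d option)" where "\<kappa>' = (\<chi> i. \<kappa> $ i + real (\<alpha> i + \<beta> i))"
  define A where "A = (\<Sum>i\<in>UNIV. \<kappa> $ i) + real CARD('d) + 1"
  have \<kappa>'_gt: "\<kappa>' $ i > -1" for i
    using \<kappa>[of i] by (simp add: \<kappa>'_def)
  \<comment> \<open>At \<open>t = 0\<close> both sides are zero because \<open>0 powr k = 0\<close>,
    even if \<open>a\<close> and \<open>b\<close> are zero.\<close>
  have pw: "t ^ a * t ^ b * t powr k = t powr (k + real (a + b))" if "t \<ge> 0" for t k :: real and a b
    using that by (cases "t = 0") (auto simp: powr_add powr_realpow)
  have W: "vmonom (hcoords x) \<alpha> * vmonom (hcoords x) \<beta> * jacobi_weight \<kappa> x = jacobi_weight \<kappa>' x"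
    if "x \<in> simplex_T" for x :: "real ^ 'd"
  proof -
    have weight: "jacobi_weight k x = (\<Prod>i\<in>UNIV. (hcoords x $ i) powr (k $ i))" for k
      by (simp add: jacobi_weight_def prod_option_UNIV hcoords_def mult.commute)
    have "hcoords x $ i \<ge> 0" for i
      using that by (cases i) (auto simp: hcoords_def simplex_T_def)
    then show ?thesis
      by (simp only: weight vmonom_def prod.distrib[symmetric] \<kappa>'_def vec_lambda_beta pw)
  qed
  have poch: "Gamma (z + real n) = pochhammer z n * Gamma z" if "z > 0" for z :: real and n
  proof -
    have "z \<notin> \<int>\<^sub>\<le>\<^sub>0" using that by (auto elim!: nonpos_Ints_cases)
    then show ?thesis using Gamma_real_pos[OF that] by (simp add: pochhammer_Gamma)
  qed
  have A0: "A > 0" using norm_const_pos[OF \<kappa>] by (simp add: A_def)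
  have A': "(\<Sum>i\<in>UNIV. \<kappa>' $ i) + real CARD('d) + 1 = A + real (sum \<alpha> UNIV + sum \<beta> UNIV)"
    by (simp add: \<kappa>'_def A_def sum.distrib)
  have "(LINT x:simplex_T|lborel. vmonom (hcoords x) \<alpha> * vmonom (hcoords x) \<beta> * jacobi_weight \<kappa> x)
    = (LINT x:simplex_T|lborel. jacobi_weight \<kappa>' x)"
    by (intro set_lebesgue_integral_cong) (auto simp: W)
  also have "\<dots> = (\<Prod>i\<in>UNIV. Gamma (\<kappa>' $ i + 1)) / Gamma (A + real (sum \<alpha> UNIV + sum \<beta> UNIV))"
    unfolding A'[symmetric] by (rule integral_jacobi_weight[OF \<kappa>'_gt])
  also have "(\<Prod>i\<in>UNIV. Gamma (\<kappa>' $ i + 1)) = (\<Prod>i\<in>UNIV. pochhammer (\<kappa> $ i + 1) (\<alpha> i + \<beta> i)) * (\<Prod>i\<in>UNIV. Gamma (\<kappa> $ i + 1))"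
    unfolding prod.distrib[symmetric]
  proof (rule prod.cong[OF refl])
    fix i
    have "\<kappa> $ i + 1 > 0" using \<kappa>[of i] by simp
    from poch[OF this, of "\<alpha> i + \<beta> i"]
    show "Gamma (\<kappa>' $ i + 1) = pochhammer (\<kappa> $ i + 1) (\<alpha> i + \<beta> i) * Gamma (\<kappa> $ i + 1)"
      by (simp add: \<kappa>'_def add_ac)
  qed
  also have "Gamma (A + real (sum \<alpha> UNIV + sum \<beta> UNIV)) = pochhammer A (sum \<alpha> UNIV + sum \<beta> UNIV) * Gamma A"
    by (rule poch[OF A0])
  finally show ?thesis
    using prod_Gamma_pos[OF \<kappa>] Gamma_real_pos[OF A0]
    unfolding jacobi_inner_def A_def[symmetric] by (simp add: less_le del: prod_zero_iff)
qed

section \<open>Orthogonal projections\<close>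

text \<open>Gram-Schmidt by induction on \<open>F\<close>. The function \<open>f\<close> is kept
  arbitrary so that the induction hypothesis also orthogonalizes the new monomial \<open>s\<close>
  against \<open>F\<close>.\<close>

lemma jacobi_orthogonalize_monomials:
  assumes "finite F" "real_polynomial_function f"
  shows "\<exists>c. \<forall>\<beta>\<in>F. jacobi_inner \<kappa> (\<lambda>x. f x - (\<Sum>\<gamma>\<in>F. c \<gamma> * vmonom x \<gamma>)) (\<lambda>x. vmonom x \<beta>) = 0"
  using assms
proof (induction F arbitrary: f rule: finite_induct)
  case empty
  then show ?case by simp
next
  case (insert s F f)
  note rp = real_polynomial_function_diff real_polynomial_function_sum real_polynomial_function_vmonom
    real_polynomial_function.intros(4) real_polynomial_function.intros(2)
  obtain d where d: "\<And>\<beta>. \<beta> \<in> F \<Longrightarrow> jacobi_inner \<kappa> (\<lambda>x. vmonom x s - (\<Sum>\<gamma>\<in>F. d \<gamma> * vmonom x \<gamma>)) (\<lambda>x. vmonom x \<beta>) = 0"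
    using insert.IH[OF real_polynomial_function_vmonom[of s]] by blast
  obtain c where c: "\<And>\<beta>. \<beta> \<in> F \<Longrightarrow> jacobi_inner \<kappa> (\<lambda>x. f x - (\<Sum>\<gamma>\<in>F. c \<gamma> * vmonom x \<gamma>)) (\<lambda>x. vmonom x \<beta>) = 0"
    using insert.IH[OF insert.prems] by blast
  define s' where "s' x = vmonom x s - (\<Sum>\<gamma>\<in>F. d \<gamma> * vmonom x \<gamma>)" for x :: "real ^ 'd"
  define g where "g x = f x - (\<Sum>\<gamma>\<in>F. c \<gamma> * vmonom x \<gamma>)" for x
  \<comment> \<open>The coefficient of the projection of \<open>g\<close> onto \<open>s'\<close>. A
    zero denominator is covered by definiteness: then \<open>s'\<close> itself is zero and
    \<open>h\<close> is trivially orthogonal to it.\<close>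
  define t where "t = jacobi_inner \<kappa> g s' / jacobi_inner \<kappa> s' s'"
  define h where "h x = g x - t * s' x" for x
  have ps: "real_polynomial_function s'" and pg: "real_polynomial_function g" and ph: "real_polynomial_function h"
    unfolding s'_def g_def h_def using insert.hyps insert.prems by (auto intro!: rp)
  have hl: "jacobi_inner \<kappa> h q = jacobi_inner \<kappa> g q - t * jacobi_inner \<kappa> s' q" if "real_polynomial_function q" for q
    unfolding h_def using that ps pg
    by (subst jacobi_inner_diff_left) (auto intro!: rp simp: jacobi_inner_cmult_left)
  have hF: "jacobi_inner \<kappa> h (\<lambda>x. vmonom x \<beta>) = 0" if "\<beta> \<in> F" for \<beta>
    using c[OF that] d[OF that]
    by (simp add: hl real_polynomial_function_vmonom flip: g_def s'_def)
  have "jacobi_inner \<kappa> h s' = 0"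
  proof (cases "jacobi_inner \<kappa> s' s' = 0")
    case True
    then have "s' = (\<lambda>_. 0)" by (rule jacobi_inner_definite[OF ps])
    then show ?thesis by (simp add: jacobi_inner_def set_lebesgue_integral_def)
  qed (simp add: hl[OF ps] t_def)
  moreover have "jacobi_inner \<kappa> h (\<lambda>x. \<Sum>\<gamma>\<in>F. d \<gamma> * vmonom x \<gamma>) = 0"
    using hF insert.hyps ph unfolding jacobi_inner_commute[of _ h]
    by (simp add: jacobi_inner_sum_left real_polynomial_function_vmonom)
  moreover have "jacobi_inner \<kappa> h s' = jacobi_inner \<kappa> h (\<lambda>x. vmonom x s) - jacobi_inner \<kappa> h (\<lambda>x. \<Sum>\<gamma>\<in>F. d \<gamma> * vmonom x \<gamma>)"
    unfolding jacobi_inner_commute[of _ h] s'_def using insert.hyps ph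
    by (intro jacobi_inner_diff_left) (auto intro!: rp)
  ultimately have hs: "jacobi_inner \<kappa> h (\<lambda>x. vmonom x s) = 0" by simp
  define c' where "c' \<gamma> = (if \<gamma> = s then t else c \<gamma> - t * d \<gamma>)" for \<gamma>
  have "(\<Sum>\<gamma>\<in>insert s F. c' \<gamma> * vmonom x \<gamma>) = t * vmonom x s + (\<Sum>\<gamma>\<in>F. (c \<gamma> - t * d \<gamma>) * vmonom x \<gamma>)" for x
  proof -
    have "(\<Sum>\<gamma>\<in>F. c' \<gamma> * vmonom x \<gamma>) = (\<Sum>\<gamma>\<in>F. (c \<gamma> - t * d \<gamma>) * vmonom x \<gamma>)"
      using insert.hyps by (intro sum.cong) (auto simp: c'_def)
    then show ?thesis using insert.hyps by (simp add: c'_def)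
  qed
  then have "(\<lambda>x. f x - (\<Sum>\<gamma>\<in>insert s F. c' \<gamma> * vmonom x \<gamma>)) = h"
    by (simp add: fun_eq_iff h_def g_def s'_def algebra_simps sum_subtractf sum_distrib_left)
  with hs hF show ?case by (intro exI[of _ c']) auto
qed

lemma poly_lt_projection_exists:
  assumes f: "real_polynomial_function f"
  shows "\<exists>p\<in>poly_lt n. \<forall>q\<in>poly_lt n. jacobi_inner \<kappa> (\<lambda>x. f x - p x) q = 0"
proof -
  obtain c where c: "\<And>\<beta>. sum \<beta> UNIV < n \<Longrightarrow>
      jacobi_inner \<kappa> (\<lambda>x. f x - (\<Sum>\<gamma> | sum \<gamma> UNIV < n. c \<gamma> * vmonom x \<gamma>)) (\<lambda>x. vmonom x \<beta>) = 0"
    using jacobi_orthogonalize_monomials[OF _ f, of "{\<beta>. sum \<beta> UNIV < n}"] by auto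
  define p where "p x = (\<Sum>\<gamma> | sum \<gamma> UNIV < n. c \<gamma> * vmonom x \<gamma>)" for x :: "real ^ 'd"
  have p: "p \<in> poly_lt n" by (auto simp: poly_lt_def p_def)
  moreover have "jacobi_inner \<kappa> (\<lambda>x. f x - p x) q = 0" if q0: "q \<in> poly_lt n" for q
  proof -
    obtain e where q: "q = (\<lambda>x. \<Sum>\<beta> | sum \<beta> UNIV < n. e \<beta> * vmonom x \<beta>)"
      using q0 by (auto simp: poly_lt_def fun_eq_iff)
    show ?thesis
      unfolding q jacobi_inner_commute[of \<kappa> "\<lambda>x. f x - p x"]
      using c[folded p_def, unfolded jacobi_inner_commute[of \<kappa> "\<lambda>x. f x - p x"]]
        f real_polynomial_function_poly_lt[OF p]
      by (simp add: jacobi_inner_sum_left real_polynomial_function_vmonom real_polynomial_function_diff)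
  qed
  ultimately show ?thesis by blast
qed

text \<open>The projection is the difference \<open>p - p'\<close> of those onto
  \<open>poly_lt (Suc n)\<close> and \<open>poly_lt n\<close>. The remainder is
  \<open>(f - p) + p'\<close>, and both summands are orthogonal to
  \<open>ortho_space \<kappa> n\<close>.\<close>

lemma ortho_proj_exists:
  assumes f: "real_polynomial_function f"
  shows "\<exists>r. is_ortho_proj \<kappa> n f r"
proof -
  obtain p where p: "p \<in> poly_lt (Suc n)" "\<And>q. q \<in> poly_lt (Suc n) \<Longrightarrow> jacobi_inner \<kappa> (\<lambda>x. f x - p x) q = 0"
    using poly_lt_projection_exists[OF f, of "Suc n"] by blast
  obtain p' where p': "p' \<in> poly_lt n" "\<And>q. q \<in> poly_lt n \<Longrightarrow> jacobi_inner \<kappa> (\<lambda>x. f x - p' x) q = 0"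
    using poly_lt_projection_exists[OF f, of n] by blast
  note rp = real_polynomial_function_poly_lt
  have up: "q \<in> poly_lt (Suc n)" if "q \<in> poly_lt n" for q :: "real ^ 'd \<Rightarrow> real"
    using poly_lt_mono[OF _ that] by simp
  have "jacobi_inner \<kappa> (\<lambda>x. p x - p' x) q = 0" if q: "q \<in> poly_lt n" for q
    using p(2)[OF up[OF q]] p'(2)[OF q] f rp[OF p(1)] rp[OF p'(1)] rp[OF q]
    by (simp add: jacobi_inner_diff_left)
  then have r: "(\<lambda>x. p x - p' x) \<in> ortho_space \<kappa> n"
    using p(1) up[OF p'(1)] by (auto simp: ortho_space_iff intro: poly_lt_diff)
  moreover have "jacobi_inner \<kappa> (\<lambda>x. f x - (p x - p' x)) q = 0" if q: "q \<in> ortho_space \<kappa> n" for q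
  proof -
    have q': "q \<in> poly_lt (Suc n)" "jacobi_inner \<kappa> p' q = 0"
      using q p'(1) by (auto simp: ortho_space_iff jacobi_inner_commute[of _ p'])
    have "jacobi_inner \<kappa> (\<lambda>x. (f x - p x) + p' x) q = 0"
      using p(2)[OF q'(1)] q'(2) f rp[OF p(1)] rp[OF p'(1)] rp[OF q'(1)]
      by (subst jacobi_inner_add_left) auto
    then show ?thesis by (simp add: algebra_simps)
  qed
  ultimately show ?thesis unfolding is_ortho_proj_def by blast
qed

lemma ortho_space_poly: "p \<in> ortho_space \<kappa> n \<Longrightarrow> real_polynomial_function p"
  using real_polynomial_function_poly_lt by (auto simp: ortho_space_iff)

lemma ortho_space_sum:
  assumes I: "finite I" and f: "\<And>i. i \<in> I \<Longrightarrow> f i \<in> ortho_space \<kappa> n"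
  shows "(\<lambda>x. \<Sum>i\<in>I. c i * f i x) \<in> ortho_space \<kappa> n"
  unfolding ortho_space_iff
proof
  show "(\<lambda>x. \<Sum>i\<in>I. c i * f i x) \<in> poly_lt (Suc n)"
    using f by (intro poly_lt_sum poly_lt_cmult) (simp add: ortho_space_iff)
  show "\<forall>q\<in>poly_lt n. jacobi_inner \<kappa> (\<lambda>x. \<Sum>i\<in>I. c i * f i x) q = 0"
  proof
    fix q :: "real ^ 'd \<Rightarrow> real" assume q: "q \<in> poly_lt n"
    have "jacobi_inner \<kappa> (\<lambda>x. \<Sum>i\<in>I. c i * f i x) q = (\<Sum>i\<in>I. c i * jacobi_inner \<kappa> (f i) q)"
      by (intro jacobi_inner_sum_left I ortho_space_poly[OF f] real_polynomial_function_poly_lt[OF q])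
    also have "\<dots> = 0"
      using f q by (intro sum.neutral) (simp add: ortho_space_iff)
    finally show "jacobi_inner \<kappa> (\<lambda>x. \<Sum>i\<in>I. c i * f i x) q = 0" .
  qed
qed

lemma ortho_space_diff:
  assumes p: "p \<in> ortho_space \<kappa> n" and q: "q \<in> ortho_space \<kappa> n"
  shows "(\<lambda>x. p x - q x) \<in> ortho_space \<kappa> n"
proof -
  have "jacobi_inner \<kappa> (\<lambda>x. p x - q x) r = 0" if "r \<in> poly_lt n" for r
    using p q that ortho_space_poly[OF p] ortho_space_poly[OF q] real_polynomial_function_poly_lt[OF that]
    by (simp add: jacobi_inner_diff_left ortho_space_iff)
  then show ?thesis
    using p q by (simp add: ortho_space_iff poly_lt_diff)
qed

text \<open>The difference of two projections lies in the space and is orthogonal to it, hence to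
  itself.\<close>

lemma is_ortho_proj_unique:
  assumes "is_ortho_proj \<kappa> n f r" "is_ortho_proj \<kappa> n f r'" "real_polynomial_function f"
  shows "r = r'"
proof -
  let ?s = "\<lambda>x. r x - r' x"
  have s: "?s \<in> ortho_space \<kappa> n" using assms by (auto simp: is_ortho_proj_def intro: ortho_space_diff)
  have rp: "real_polynomial_function r" "real_polynomial_function r'" "real_polynomial_function ?s"
    using assms s by (auto simp: is_ortho_proj_def intro: ortho_space_poly)
  have "jacobi_inner \<kappa> (\<lambda>x. f x - r x) ?s = 0" "jacobi_inner \<kappa> (\<lambda>x. f x - r' x) ?s = 0"
    using assms s by (auto simp: is_ortho_proj_def)
  then have "jacobi_inner \<kappa> r ?s = jacobi_inner \<kappa> r' ?s"
    using rp assms(3) by (simp add: jacobi_inner_diff_left)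
  then have "jacobi_inner \<kappa> ?s ?s = 0"
    by (subst jacobi_inner_diff_left) (auto simp: rp)
  then have "?s = (\<lambda>_. 0)" by (intro jacobi_inner_definite rp)
  then show ?thesis by (simp add: fun_eq_iff)
qed

lemma is_ortho_proj_R_proj: "is_ortho_proj \<kappa> n (\<lambda>x. vmonom (hcoords x) \<alpha>) (R_proj \<kappa> n \<alpha>)"
proof -
  have "\<exists>!r. is_ortho_proj \<kappa> n (\<lambda>x. vmonom (hcoords x) \<alpha>) r"
    using ortho_proj_exists[OF real_polynomial_function_vmonom_hcoords]
      is_ortho_proj_unique[OF _ _ real_polynomial_function_vmonom_hcoords] by blast
  then show ?thesis
    unfolding R_proj_def ortho_proj_def by (rule theI')
qed

text \<open>For fixed \<open>x\<close>, both kernels reproduce the difference of their sections at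
  \<open>x\<close>, so this difference has norm zero.\<close>

lemma reproducing_kernel_unique:
  assumes P: "is_reproducing_kernel \<kappa> n P" and P': "is_reproducing_kernel \<kappa> n P'"
  shows "P = P'"
proof
  fix x
  let ?s = "\<lambda>y. P x y - P' x y"
  have mem: "P x \<in> ortho_space \<kappa> n" "P' x \<in> ortho_space \<kappa> n"
    using P P' by (auto simp: is_reproducing_kernel_def)
  then have s: "?s \<in> ortho_space \<kappa> n" by (rule ortho_space_diff)
  have "jacobi_inner \<kappa> (P x) ?s = ?s x" "jacobi_inner \<kappa> (P' x) ?s = ?s x"
    using s P P' unfolding is_reproducing_kernel_def by blast+
  then have "jacobi_inner \<kappa> ?s ?s = 0"
    using mem s by (subst jacobi_inner_diff_left) (auto intro: ortho_space_poly)
  then have "?s = (\<lambda>_. 0)" using ortho_space_poly[OF s] by (intro jacobi_inner_definite)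
  then show "P x = P' x" by (simp add: fun_eq_iff)
qed

end

subsection \<open>The reproducing kernel\<close>

text \<open>\<open>(-1) ^ n\<close> times the Pochhammer symbol of \<open>- real N\<close> is
  N(N-1)...(N-n+1), which divides \<open>fact N\<close> with quotient
  \<open>fact (N - n)\<close>.\<close>

lemma kernel_constant:
  assumes "n \<le> N"
  shows "pochhammer A (N + n) * fact N / ((-1) ^ n * pochhammer (- real N) n) = pochhammer A (N + n) * fact (N - n)"
proof -
  have "fact N = fact (N - n) * pochhammer (real N - real n + 1) n"
    using assms pochhammer_product[of "N - n" N "1::real"]
    by (simp add: pochhammer_fact[symmetric] of_nat_diff add_ac)
  moreover have "(-1) ^ n * pochhammer (- real N) n = pochhammer (real N - real n + 1) n"
    by (simp add: pochhammer_minus mult.assoc[symmetric] power_mult_distrib[symmetric])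
  moreover have "fact N \<noteq> (0::real)" by simp
  ultimately show ?thesis by (simp del: fact_nonzero)
qed

section \<open>The Bernstein--Durrmeyer operator\<close>

definition dirichlet_coeff :: "real ^ 'i::finite \<Rightarrow> ('i \<Rightarrow> nat) \<Rightarrow> real" where
  "dirichlet_coeff \<kappa> \<alpha> = 1 / ((\<Prod>i\<in>UNIV. pochhammer (\<kappa> $ i + 1) (\<alpha> i)) * (\<Prod>i\<in>UNIV. fact (\<alpha> i)))"

text \<open>The operator \<open>T\<close> above. With the Bernstein basis
  \<open>fact N / \<alpha>! * X^\<alpha>\<close>, the operator normalized to fix constants is this
  one times \<open>fact N\<close> and the Pochhammer symbol of order \<open>N\<close> at
  \<open>|\<kappa>| + d + 1\<close>.\<close>

definition durrmeyer ::
  "real ^ ('d option) \<Rightarrow> nat \<Rightarrow> (real ^ 'd::finite \<Rightarrow> real) \<Rightarrow> real ^ 'd \<Rightarrow> real" where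
  "durrmeyer \<kappa> N Q x = (\<Sum>\<alpha> | sum \<alpha> UNIV = N.
     dirichlet_coeff \<kappa> \<alpha> * jacobi_inner \<kappa> (\<lambda>x. vmonom (hcoords x) \<alpha>) Q * vmonom (hcoords x) \<alpha>)"

text \<open>The constant \<open>C\<close> above, in the simplified form supplied by
  \<open>kernel_constant\<close>.\<close>

definition norm_factor :: "real ^ ('d::finite option) \<Rightarrow> nat \<Rightarrow> nat \<Rightarrow> real" where
  "norm_factor \<kappa> n N =
     pochhammer ((\<Sum>i\<in>UNIV. \<kappa> $ i) + real CARD('d) + 1) (N + n) * fact (N - n)"

context
  fixes \<kappa> :: "real ^ ('d::finite option)" and n N :: nat
  assumes \<kappa>: "\<And>i. \<kappa> $ i > -1" and n_le: "n \<le> N"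
begin

text \<open>In the moment, the Pochhammer symbol of order \<open>\<alpha> + \<beta>\<close> splits
  at \<open>\<alpha>\<close>, and \<open>dirichlet_coeff\<close> cancels the first factor. What
  remains is the sum in \<open>durrmeyer_leading_term\<close> over a Pochhammer symbol of order
  \<open>N + |\<beta>|\<close>.\<close>

lemma durrmeyer_vmonom:
  assumes "sum \<beta> UNIV \<le> n"
  shows "(\<lambda>x. durrmeyer \<kappa> N (\<lambda>x. vmonom x \<beta>) x - vmonom x \<beta> / norm_factor \<kappa> n N) \<in> poly_lt n"
proof -
  define k where "k = sum \<beta> UNIV"
  define A where "A = (\<Sum>i\<in>UNIV. \<kappa> $ i) + real CARD('d) + 1"
  define G where "G x = (\<Sum>\<alpha> | sum \<alpha> UNIV = N. vmonom (hcoords x) \<alpha> / (\<Prod>i\<in>UNIV. fact (\<alpha> i))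
      * (\<Prod>i\<in>UNIV. pochhammer ((\<kappa> $ i + 1) + real (\<alpha> i)) (ext0 \<beta> i)))" for x :: "real ^ 'd"
  have G: "(\<lambda>x. G x - vmonom x \<beta> / fact (N - k)) \<in> poly_lt n"
    using durrmeyer_leading_term[of \<beta> N "\<lambda>i. \<kappa> $ i + 1"] assms n_le
    by (intro poly_lt_mono[of k n]) (auto simp: G_def k_def)
  have D: "durrmeyer \<kappa> N (\<lambda>x. vmonom x \<beta>) x = (1 / pochhammer A (N + k)) * G x" for x
  proof -
    have "durrmeyer \<kappa> N (\<lambda>x. vmonom x \<beta>) x = (\<Sum>\<alpha> | sum \<alpha> UNIV = N.
      (1 / pochhammer A (N + k)) * (vmonom (hcoords x) \<alpha> / (\<Prod>i\<in>UNIV. fact (\<alpha> i))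
      * (\<Prod>i\<in>UNIV. pochhammer ((\<kappa> $ i + 1) + real (\<alpha> i)) (ext0 \<beta> i))))"
      unfolding durrmeyer_def
    proof (rule sum.cong[OF refl])
      fix \<alpha> :: "'d option \<Rightarrow> nat" assume \<alpha>: "\<alpha> \<in> {\<alpha>. sum \<alpha> UNIV = N}"
      have pos: "(\<Prod>i\<in>UNIV. pochhammer (\<kappa> $ i + 1) (\<alpha> i)) > 0"
      proof (intro prod_pos ballI pochhammer_pos)
        show "\<kappa> $ i + 1 > 0" for i using \<kappa>[of i] by simp
      qed
      have "jacobi_inner \<kappa> (\<lambda>x. vmonom (hcoords x) \<alpha>) (\<lambda>x. vmonom x \<beta>)
        = (\<Prod>i\<in>UNIV. pochhammer (\<kappa> $ i + 1) (\<alpha> i)) * (\<Prod>i\<in>UNIV. pochhammer ((\<kappa> $ i + 1) + real (\<alpha> i)) (ext0 \<beta> i))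
          / pochhammer A (N + k)"
        using jacobi_moment[OF \<kappa>, of \<alpha> "ext0 \<beta>"] \<alpha>
        by (simp only: vmonom_hcoords_ext0 sum_ext0 k_def A_def pochhammer_product' prod.distrib mem_Collect_eq)
      then show "dirichlet_coeff \<kappa> \<alpha> * jacobi_inner \<kappa> (\<lambda>x. vmonom (hcoords x) \<alpha>) (\<lambda>x. vmonom x \<beta>) * vmonom (hcoords x) \<alpha>
         = (1 / pochhammer A (N + k)) * (vmonom (hcoords x) \<alpha> / (\<Prod>i\<in>UNIV. fact (\<alpha> i))
          * (\<Prod>i\<in>UNIV. pochhammer ((\<kappa> $ i + 1) + real (\<alpha> i)) (ext0 \<beta> i)))"
        using pos by (simp add: dirichlet_coeff_def less_le mult_ac del: prod_zero_iff)
    qed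
    then show ?thesis by (simp add: G_def sum_distrib_left)
  qed
  show ?thesis
  proof (cases "k = n")
    case True
    have "durrmeyer \<kappa> N (\<lambda>x. vmonom x \<beta>) x - vmonom x \<beta> / norm_factor \<kappa> n N
      = (1 / pochhammer A (N + n)) * (G x - vmonom x \<beta> / fact (N - k))" for x
      by (simp add: D True norm_factor_def A_def[symmetric] right_diff_distrib)
    then show ?thesis by (simp only: poly_lt_cmult[OF G])
  next
    case False
    \<comment> \<open>The constant matches only in degree exactly \<open>n\<close>; below that
      degree, every multiple of the monomial is already in \<open>poly_lt n\<close>.\<close>
    then have v: "(\<lambda>x :: real ^ 'd. vmonom x \<beta>) \<in> poly_lt n"
      using assms by (intro poly_lt_vmonom) (simp add: k_def)
    have "durrmeyer \<kappa> N (\<lambda>x. vmonom x \<beta>) x - vmonom x \<beta> / norm_factor \<kappa> n N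
      = (1 / pochhammer A (N + k)) * (G x - vmonom x \<beta> / fact (N - k))
        + (1 / (pochhammer A (N + k) * fact (N - k)) - 1 / norm_factor \<kappa> n N) * vmonom x \<beta>" for x
      by (simp add: D algebra_simps)
    then show ?thesis
      by (simp only: poly_lt_add[OF poly_lt_cmult[OF G] poly_lt_cmult[OF v]])
  qed
qed

lemma durrmeyer_leading:
  assumes Q: "Q \<in> poly_lt (Suc n)"
  shows "(\<lambda>x. durrmeyer \<kappa> N Q x - Q x / norm_factor \<kappa> n N) \<in> poly_lt n"
proof -
  obtain c where c: "Q = (\<lambda>x. \<Sum>\<beta> | sum \<beta> UNIV < Suc n. c \<beta> * vmonom x \<beta>)"
    using Q by (auto simp: poly_lt_def fun_eq_iff)
  have inner: "jacobi_inner \<kappa> f Q = (\<Sum>\<beta> | sum \<beta> UNIV < Suc n. c \<beta> * jacobi_inner \<kappa> f (\<lambda>x. vmonom x \<beta>))"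
    if "real_polynomial_function f" for f
    unfolding c jacobi_inner_commute[of \<kappa> f]
    by (intro jacobi_inner_sum_left[OF \<kappa>] that real_polynomial_function_vmonom finite_multi_indices)
  have "durrmeyer \<kappa> N Q x = (\<Sum>\<beta> | sum \<beta> UNIV < Suc n. c \<beta> * durrmeyer \<kappa> N (\<lambda>x. vmonom x \<beta>) x)" for x
    unfolding durrmeyer_def inner[OF real_polynomial_function_vmonom_hcoords]
    by (simp only: sum_distrib_left sum_distrib_right, subst sum.swap) (simp only: mult_ac)
  then have "durrmeyer \<kappa> N Q x - Q x / norm_factor \<kappa> n N
    = (\<Sum>\<beta> | sum \<beta> UNIV < Suc n. c \<beta> * (durrmeyer \<kappa> N (\<lambda>x. vmonom x \<beta>) x - vmonom x \<beta> / norm_factor \<kappa> n N))" for x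
    by (simp add: c right_diff_distrib sum_subtractf sum_divide_distrib)
  moreover have "(\<lambda>x. \<Sum>\<beta> | sum \<beta> UNIV < Suc n. c \<beta> * (durrmeyer \<kappa> N (\<lambda>x. vmonom x \<beta>) x - vmonom x \<beta> / norm_factor \<kappa> n N)) \<in> poly_lt n"
    by (intro poly_lt_sum poly_lt_cmult durrmeyer_vmonom) simp
  ultimately show ?thesis by simp
qed

lemma norm_factor_pos: "norm_factor \<kappa> n N > 0"
  unfolding norm_factor_def using norm_const_pos[OF \<kappa>]
  by (intro mult_pos_pos pochhammer_pos) auto

section \<open>Projected monomials and the reproducing property\<close>

lemma R_proj_in_ortho_space: "R_proj \<kappa> n \<alpha> \<in> ortho_space \<kappa> n"
  using is_ortho_proj_R_proj[OF \<kappa>] by (simp add: is_ortho_proj_def)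

text \<open>\<open>X^\<alpha>\<close> minus its projection is orthogonal to \<open>Q\<close>. Inside
  the kernel this replaces inner products with \<open>R_proj\<close> by those in
  \<open>durrmeyer\<close>.\<close>

lemma R_proj_inner:
  assumes Q: "Q \<in> ortho_space \<kappa> n"
  shows "jacobi_inner \<kappa> (R_proj \<kappa> n \<alpha>) Q = jacobi_inner \<kappa> (\<lambda>x. vmonom (hcoords x) \<alpha>) Q"
proof -
  have "jacobi_inner \<kappa> (\<lambda>x. vmonom (hcoords x) \<alpha> - R_proj \<kappa> n \<alpha> x) Q = 0"
    using is_ortho_proj_R_proj[OF \<kappa>] Q by (simp add: is_ortho_proj_def)
  then show ?thesis
    using jacobi_inner_diff_left[OF \<kappa> real_polynomial_function_vmonom_hcoords
        ortho_space_poly[OF \<kappa> R_proj_in_ortho_space] ortho_space_poly[OF \<kappa> Q]] by simp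
qed

text \<open>Both sides are orthogonal projections of \<open>durrmeyer \<kappa> N Q\<close>: the left
  by projecting term by term, the right because the remainder has degree below
  \<open>n\<close>.\<close>

lemma R_proj_reproduces:
  assumes Q: "Q \<in> ortho_space \<kappa> n"
  shows "(\<Sum>\<alpha> | sum \<alpha> UNIV = N.
     dirichlet_coeff \<kappa> \<alpha> * jacobi_inner \<kappa> (\<lambda>x. vmonom (hcoords x) \<alpha>) Q * R_proj \<kappa> n \<alpha> x) = Q x / norm_factor \<kappa> n N"
proof -
  let ?b = "\<lambda>\<alpha>. dirichlet_coeff \<kappa> \<alpha> * jacobi_inner \<kappa> (\<lambda>x. vmonom (hcoords x) \<alpha>) Q"
  let ?S = "\<lambda>x. \<Sum>\<alpha> | sum \<alpha> UNIV = N. ?b \<alpha> * R_proj \<kappa> n \<alpha> x"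
  \<comment> \<open>Closure under scalar multiples is the case of a sum with one term.\<close>
  have Q': "(\<lambda>x. (1 / norm_factor \<kappa> n N) * Q x) \<in> ortho_space \<kappa> n"
    using ortho_space_sum[OF \<kappa>, of "{()}" "\<lambda>_. Q" n "\<lambda>_. 1 / norm_factor \<kappa> n N"] Q by simp
  have S: "?S \<in> ortho_space \<kappa> n"
    by (intro ortho_space_sum[OF \<kappa>] R_proj_in_ortho_space finite_multi_indices)
  have pd: "real_polynomial_function (durrmeyer \<kappa> N Q)"
    unfolding durrmeyer_def[abs_def]
    by (intro real_polynomial_function_sum real_polynomial_function.intros(2,4)
        real_polynomial_function_vmonom_hcoords finite_multi_indices)
  have "is_ortho_proj \<kappa> n (durrmeyer \<kappa> N Q) ?S"
    unfolding is_ortho_proj_def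
  proof (intro conjI S ballI)
    fix q assume q: "q \<in> ortho_space \<kappa> n"
    have "durrmeyer \<kappa> N Q x - ?S x = (\<Sum>\<alpha> | sum \<alpha> UNIV = N. ?b \<alpha> * (vmonom (hcoords x) \<alpha> - R_proj \<kappa> n \<alpha> x))" for x
      by (simp add: durrmeyer_def right_diff_distrib sum_subtractf)
    then have "jacobi_inner \<kappa> (\<lambda>x. durrmeyer \<kappa> N Q x - ?S x) q
      = (\<Sum>\<alpha> | sum \<alpha> UNIV = N. ?b \<alpha> * jacobi_inner \<kappa> (\<lambda>x. vmonom (hcoords x) \<alpha> - R_proj \<kappa> n \<alpha> x) q)"
      by (simp only:) (intro jacobi_inner_sum_left[OF \<kappa>] real_polynomial_function_diff finite_multi_indices
          real_polynomial_function_vmonom_hcoords ortho_space_poly[OF \<kappa> R_proj_in_ortho_space]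
          ortho_space_poly[OF \<kappa> q])
    also have "\<dots> = 0"
      using is_ortho_proj_R_proj[OF \<kappa>] q by (intro sum.neutral) (simp add: is_ortho_proj_def)
    finally show "jacobi_inner \<kappa> (\<lambda>x. durrmeyer \<kappa> N Q x - ?S x) q = 0" .
  qed
  moreover have "is_ortho_proj \<kappa> n (durrmeyer \<kappa> N Q) (\<lambda>x. (1 / norm_factor \<kappa> n N) * Q x)"
    unfolding is_ortho_proj_def
  proof (intro conjI Q' ballI)
    fix q assume q: "q \<in> ortho_space \<kappa> n"
    have "(\<lambda>x. durrmeyer \<kappa> N Q x - (1 / norm_factor \<kappa> n N) * Q x) \<in> poly_lt n"
      using durrmeyer_leading Q by (simp add: ortho_space_iff)
    then show "jacobi_inner \<kappa> (\<lambda>x. durrmeyer \<kappa> N Q x - (1 / norm_factor \<kappa> n N) * Q x) q = 0"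
      using q by (subst jacobi_inner_commute) (simp add: ortho_space_iff)
  qed
  ultimately have "?S = (\<lambda>x. (1 / norm_factor \<kappa> n N) * Q x)"
    by (rule is_ortho_proj_unique[OF \<kappa> _ _ pd])
  then show ?thesis by (simp add: fun_eq_iff)
qed

text \<open>Pairing with \<open>Q\<close> in the second variable turns the sum into the one of
  \<open>R_proj_reproduces\<close>, and \<open>norm_factor\<close> cancels its denominator.\<close>

lemma R_proj_kernel:
  "is_reproducing_kernel \<kappa> n (\<lambda>x y. norm_factor \<kappa> n N *
    (\<Sum>\<alpha> | sum \<alpha> UNIV = N. dirichlet_coeff \<kappa> \<alpha> * R_proj \<kappa> n \<alpha> x * R_proj \<kappa> n \<alpha> y))"
proof -
  have K: "norm_factor \<kappa> n N * (\<Sum>\<alpha> | sum \<alpha> UNIV = N. dirichlet_coeff \<kappa> \<alpha> * R_proj \<kappa> n \<alpha> x * R_proj \<kappa> n \<alpha> y)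
    = (\<Sum>\<alpha> | sum \<alpha> UNIV = N. (norm_factor \<kappa> n N * dirichlet_coeff \<kappa> \<alpha> * R_proj \<kappa> n \<alpha> x) * R_proj \<kappa> n \<alpha> y)" for x y
    by (simp add: sum_distrib_left mult.assoc)
  \<comment> \<open>By this symmetry, membership in the first variable reduces to membership in the
    second.\<close>
  have K': "(\<Sum>\<alpha> | sum \<alpha> UNIV = N. (norm_factor \<kappa> n N * dirichlet_coeff \<kappa> \<alpha> * R_proj \<kappa> n \<alpha> x) * R_proj \<kappa> n \<alpha> y)
    = (\<Sum>\<alpha> | sum \<alpha> UNIV = N. (norm_factor \<kappa> n N * dirichlet_coeff \<kappa> \<alpha> * R_proj \<kappa> n \<alpha> y) * R_proj \<kappa> n \<alpha> x)" for x y
    by (simp only: mult_ac)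
  have mem: "(\<lambda>y. \<Sum>\<alpha> | sum \<alpha> UNIV = N. (norm_factor \<kappa> n N * dirichlet_coeff \<kappa> \<alpha> * R_proj \<kappa> n \<alpha> x) * R_proj \<kappa> n \<alpha> y)
    \<in> ortho_space \<kappa> n" for x
    by (intro ortho_space_sum[OF \<kappa>] R_proj_in_ortho_space finite_multi_indices)
  have rep: "jacobi_inner \<kappa> (\<lambda>y. \<Sum>\<alpha> | sum \<alpha> UNIV = N. (norm_factor \<kappa> n N * dirichlet_coeff \<kappa> \<alpha> * R_proj \<kappa> n \<alpha> x) * R_proj \<kappa> n \<alpha> y) Q
    = Q x" if Q: "Q \<in> ortho_space \<kappa> n" for Q x
  proof -
    have "jacobi_inner \<kappa> (\<lambda>y. \<Sum>\<alpha> | sum \<alpha> UNIV = N. (norm_factor \<kappa> n N * dirichlet_coeff \<kappa> \<alpha> * R_proj \<kappa> n \<alpha> x) * R_proj \<kappa> n \<alpha> y) Q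
      = (\<Sum>\<alpha> | sum \<alpha> UNIV = N. (norm_factor \<kappa> n N * dirichlet_coeff \<kappa> \<alpha> * R_proj \<kappa> n \<alpha> x) * jacobi_inner \<kappa> (R_proj \<kappa> n \<alpha>) Q)"
      by (intro jacobi_inner_sum_left[OF \<kappa>] finite_multi_indices ortho_space_poly[OF \<kappa> R_proj_in_ortho_space]
          ortho_space_poly[OF \<kappa> Q])
    also have "\<dots> = norm_factor \<kappa> n N * (\<Sum>\<alpha> | sum \<alpha> UNIV = N.
        dirichlet_coeff \<kappa> \<alpha> * jacobi_inner \<kappa> (\<lambda>x. vmonom (hcoords x) \<alpha>) Q * R_proj \<kappa> n \<alpha> x)"
      by (simp add: R_proj_inner[OF Q] sum_distrib_left mult_ac)
    also have "\<dots> = Q x"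
      using norm_factor_pos by (simp add: R_proj_reproduces[OF Q])
    finally show ?thesis .
  qed
  show ?thesis
    unfolding is_reproducing_kernel_def K using mem rep by (subst K') blast
qed

end

theorem theorem3p9:
  fixes \<kappa> :: "real ^ ('d::finite option)" and n N :: nat and x y :: "real ^ 'd"
  assumes "\<And>i. \<kappa> $ i > -1" and "n \<le> N"
  shows "jacobi_kernel \<kappa> n x y =
    pochhammer ((\<Sum>i\<in>UNIV. \<kappa> $ i) + real CARD('d) + 1) (N + n) * fact N
      / ((-1) ^ n * pochhammer (- real N) n)
    * (\<Sum>\<alpha> | sum \<alpha> UNIV = N.
         1 / ((\<Prod>i\<in>UNIV. pochhammer (\<kappa> $ i + 1) (\<alpha> i)) * (\<Prod>i\<in>UNIV. fact (\<alpha> i)))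
         * R_proj \<kappa> n \<alpha> x * R_proj \<kappa> n \<alpha> y)"
proof -
  let ?K = "\<lambda>x y :: real ^ 'd. norm_factor \<kappa> n N *
    (\<Sum>\<alpha> | sum \<alpha> UNIV = N. dirichlet_coeff \<kappa> \<alpha> * R_proj \<kappa> n \<alpha> x * R_proj \<kappa> n \<alpha> y)"
  have K: "is_reproducing_kernel \<kappa> n ?K"
    using assms by (rule R_proj_kernel)
  have "jacobi_kernel \<kappa> n = ?K"
    unfolding jacobi_kernel_def
  proof (rule the_equality)
    show "is_reproducing_kernel \<kappa> n ?K" by (rule K)
    show "P = ?K" if "is_reproducing_kernel \<kappa> n P" for P
      using assms(1) that K by (rule reproducing_kernel_unique)
  qed
  then show ?thesis
    by (simp only: kernel_constant[OF assms(2)] norm_factor_def dirichlet_coeff_def)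
qed

end
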